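(* Let $1\le q\le d-1$, let $\mathsf D$ be a Borel probability measure on $\mathbf R^d$ with zero mean and finite second moment, and let $\Sigma_{\mathsf D}=\mathbb E_{\mathsf D}[xx^\top]$. For the principal component analysis problem $$\max_{R\in\mathrm{Gr}(q,d)}\ \mathbb E_{x\sim\mathsf D}\|Rx\|_2^2,$$ the radius of statistical efficiency is $$\mathrm{RSE}(\mathsf D)=\tfrac1{\sqrt2}\Big(\sqrt{\lambda_q(\Sigma_{\mathsf D})}-\sqrt{\lambda_{q+1}(\Sigma_{\mathsf D})}\Big).$$ In particular, if $\mathsf D\in\mathcal P_2^\circ\setminus\mathcal E$, then $$\mathrm{RSE}(\mathsf D)\cdot\mathrm{REG}(\mathsf D)=\frac{1}{\sqrt2\big(\sqrt{\lambda_q(\Sigma_{\mathsf D})}+\sqrt{\lambda_{q+1}(\Sigma_{\mathsf D})}\big)}.$$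
   Context: $\mathrm{Gr}(q,d)$ is the Grassmannian manifold of all orthogonal projection matrices $R\in\mathbf S^d$ onto $q$-dimensional subspaces of $\mathbf R^d$, embedded in the space $\mathbf S^d$ of symmetric $d\times d$ matrices with the trace inner product. $\mathcal P_2^\circ$ is the set of centered Borel probability measures on $\mathbf R^d$ with finite second moment; $\lambda_1\ge\lambda_2\ge\dots\ge\lambda_d$ are ordered eigenvalues. $W_2(\mu,\nu)=\min_{\pi\in\Pi(\mu,\nu)}(\mathbb E_{(x,y)\sim\pi}\|x-y\|_2^2)^{1/2}$ over couplings and $W_2(\mu,\mathcal E)=\inf_{\nu\in\mathcal E}W_2(\mu,\nu)$. Tilt-stability and REG: for a $C^2$ embedded submanifold $\mathcal M$ of a Euclidean space and $C^2$-smooth $f$ on $\mathcal M$, a minimizer $\beta_\star$ of $f$ over $\mathcal M$ is tilt-stable if for some $\varepsilon>0$ the map $\sigma(v)=\operatorname{argmin}_{\beta\in\mathcal M\cap B_\varepsilon(\beta_\star)}\{f(\beta)-\langle v,\beta\rangle\}$ satisfies $\sigma(0)=\beta_\star$ and is single-valued and $C^1$-smooth on a neighborhood of the origin; then $\mathrm{REG}=\|\nabla\sigma(0)\|_{\rm op}$. Otherwise the minimizer is called unstable and $\mathrm{REG}=+\infty$. For a maximization problem these notions are applied to the minimization of the negated objective. For $\mu\in\mathcal P_2^\circ$, $\mathrm{REG}(\mu)$ is the regularity modulus of the problem $\max_{R\in\mathrm{Gr}(q,d)}\mathbb E_{x\sim\mu}\|Rx\|_2^2$ at its maximizer. RSE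 (unsupervised, permissible set $\mathcal P_2^\circ$): $\mathcal E=\{\mu\in\mathcal P_2^\circ:\text{the problem }\max_{R\in\mathrm{Gr}(q,d)}\mathbb E_{x\sim\mu}\|Rx\|_2^2\text{ has an unstable maximizer}\}$ and $\mathrm{RSE}(\mathsf D)=W_2(\mathsf D,\mathcal E)$. *)

theory Defs
  imports "HOL-Probability.Probability" "HOL-Computational_Algebra.Polynomial"
begin
typedef 'n symmat = "{A :: real ^ 'n ^ 'n :: finite. transpose A = A}"
  morphisms mat_of symm
  by (rule exI [of _ 0]) (simp add: transpose_def zero_vec_def)

lemma transpose_mat_of [simp]: "transpose (mat_of A) = mat_of A"
  using mat_of [of A] by simp

lemma mat_of_sym: "mat_of A $ i $ j = mat_of A $ j $ i"
proof -
  have "transpose (mat_of A) $ j $ i = mat_of A $ i $ j"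
    by (simp add: transpose_def)
  then show ?thesis by simp
qed

lemma symmat_eq_iff: "A = B \<longleftrightarrow> mat_of A = mat_of B"
  by (simp add: mat_of_inject)

instantiation symmat :: (finite) real_vector
begin

definition zero_symmat :: "'a symmat" where "0 = symm 0"
definition plus_symmat :: "'a symmat \<Rightarrow> 'a symmat \<Rightarrow> 'a symmat" where
  "A + B = symm (mat_of A + mat_of B)"
definition minus_symmat :: "'a symmat \<Rightarrow> 'a symmat \<Rightarrow> 'a symmat" where
  "A - B = symm (mat_of A - mat_of B)"
definition uminus_symmat :: "'a symmat \<Rightarrow> 'a symmat" where "- A = symm (- mat_of A)"
definition scaleR_symmat :: "real \<Rightarrow> 'a symmat \<Rightarrow> 'a symmat" where
  "c *\<^sub>R A = symm (c *\<^sub>R mat_of A)"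

lemma mat_of_zero [simp]: "mat_of 0 = 0"
  unfolding zero_symmat_def by (rule symm_inverse) (simp add: transpose_def zero_vec_def)

lemma mat_of_add [simp]: "mat_of (A + B) = mat_of A + mat_of B"
  unfolding plus_symmat_def
  by (rule symm_inverse) (simp add: transpose_def vec_eq_iff mat_of_sym)

lemma mat_of_diff [simp]: "mat_of (A - B) = mat_of A - mat_of B"
  unfolding minus_symmat_def
  by (rule symm_inverse) (simp add: transpose_def vec_eq_iff mat_of_sym)

lemma mat_of_uminus [simp]: "mat_of (- A) = - mat_of A"
  unfolding uminus_symmat_def
  by (rule symm_inverse) (simp add: transpose_def vec_eq_iff mat_of_sym)

lemma mat_of_scaleR [simp]: "mat_of (c *\<^sub>R A) = c *\<^sub>R mat_of A"
  unfolding scaleR_symmat_def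
  by (rule symm_inverse) (simp add: transpose_def vec_eq_iff mat_of_sym)

instance
  by standard (simp_all add: symmat_eq_iff algebra_simps)

end

instantiation symmat :: (finite) real_inner
begin

definition inner_symmat :: "'a symmat \<Rightarrow> 'a symmat \<Rightarrow> real" where
  "A \<bullet> B = trace (mat_of A ** mat_of B)"
definition norm_symmat_def: "norm (A :: 'a symmat) = sqrt (A \<bullet> A)"
definition "dist A B = norm (A - B :: 'a symmat)"
definition "sgn A = A /\<^sub>R norm (A :: 'a symmat)"
definition [code del]:
  "(uniformity :: ('a symmat \<times> 'a symmat) filter)
     = (INF e\<in>{0<..}. principal {(x, y). dist x y < e})"
definition [code del]:
  "open (U :: 'a symmat set)
     \<longleftrightarrow> (\<forall>x\<in>U. eventually (\<lambda>(x', y). x' = x \<longrightarrow> y \<in> U) uniformity)"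

lemma inner_symmat_eq: "A \<bullet> B = mat_of A \<bullet> mat_of (B :: 'a symmat)"
  by (simp add: inner_symmat_def trace_def matrix_matrix_mult_def inner_vec_def mat_of_sym [of B])

instance
proof
  fix A B C :: "'a symmat" and a :: real
  show "dist A B = norm (A - B)" "sgn A = A /\<^sub>R norm A"
    by (simp_all add: dist_symmat_def sgn_symmat_def)
  show "uniformity = (INF e\<in>{0<..}. principal {(x, y). dist x (y :: 'a symmat) < e})"
    by (rule uniformity_symmat_def)
  show "open U \<longleftrightarrow> (\<forall>x\<in>U. eventually (\<lambda>(x', y). x' = x \<longrightarrow> y \<in> U) uniformity)"
    for U :: "'a symmat set"
    by (rule open_symmat_def)
  show "A \<bullet> B = B \<bullet> A" "(A + B) \<bullet> C = A \<bullet> C + B \<bullet> C" "(a *\<^sub>R A) \<bullet> B = a * (A \<bullet> B)"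
    "0 \<le> A \<bullet> A" "A \<bullet> A = 0 \<longleftrightarrow> A = 0"
    by (simp_all add: inner_symmat_eq symmat_eq_iff inner_add_left)
      (rule inner_commute)
  show "norm A = sqrt (A \<bullet> A)"
    by (rule norm_symmat_def)
qed

end

lemma symmat_orthonormal_basis:
  "\<exists>B :: 'n::finite symmat set. finite B \<and> B \<noteq> {} \<and>
     (\<forall>u\<in>B. \<forall>v\<in>B. u \<bullet> v = (if u = v then 1 else 0)) \<and>
     (\<forall>x. (\<forall>u\<in>B. x \<bullet> u = 0) \<longleftrightarrow> x = 0)"
proof -
  let ?S = "range (mat_of :: 'n symmat \<Rightarrow> _)"
  have sub: "subspace ?S"
    using linear_subspace_image [OF linearI subspace_UNIV, of mat_of] by simp
  obtain B where B: "B \<subseteq> ?S" "pairwise orthogonal B" "\<And>x. x \<in> B \<Longrightarrow> norm x = 1"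
    "independent B" "span B = ?S"
    using orthonormal_basis_subspace [OF sub] by metis
  define C where "C = mat_of -` B"
  have img: "mat_of ` C = B"
    using B(1) by (auto simp: C_def)
  have fin: "finite C"
    unfolding C_def using B(4)
    by (intro finite_vimageI) (auto simp: independent_imp_finite inj_def mat_of_inject)
  have on: "u \<bullet> v = (if u = v then 1 else 0)" if "u \<in> C" "v \<in> C" for u v
    using that B(2,3)
    by (auto simp: C_def inner_symmat_eq symmat_eq_iff pairwise_def orthogonal_def norm_eq_1)
  have zero: "x = 0" if "\<forall>u\<in>C. x \<bullet> u = 0" for x
  proof -
    have "orthogonal (mat_of x) y" if "y \<in> B" for y
      using that \<open>\<forall>u\<in>C. x \<bullet> u = 0\<close> img by (auto simp: inner_symmat_eq orthogonal_def)
    then have "orthogonal (mat_of x) (mat_of x)"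
      using B(5) by (metis orthogonal_to_span rangeI)
    then show ?thesis
      by (simp add: orthogonal_def symmat_eq_iff)
  qed
  have "transpose (mat 1 :: real ^ 'n ^ 'n) = mat 1"
    by simp
  then have one: "mat_of (symm (mat 1) :: 'n symmat) = mat 1"
    by (simp add: symm_inverse)
  have "(mat 1 :: real ^ 'n ^ 'n) \<noteq> 0"
    by (auto simp: mat_def vec_eq_iff)
  then have "symm (mat 1) \<noteq> (0 :: 'n symmat)"
    by (metis one mat_of_zero)
  then have "C \<noteq> {}"
    using zero by blast
  moreover have "(\<forall>u\<in>C. x \<bullet> u = 0) \<longleftrightarrow> x = 0" for x
    using zero by (metis inner_zero_left)
  ultimately show ?thesis
    using fin on by (intro exI [of _ C] conjI ballI allI) simp_all
qed

instantiation symmat :: (finite) euclidean_space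
begin

text \<open>There is no canonical ordering of the index type, so an arbitrary orthonormal basis is chosen.\<close>

definition "Basis = (SOME B :: 'a symmat set. finite B \<and> B \<noteq> {} \<and>
     (\<forall>u\<in>B. \<forall>v\<in>B. u \<bullet> v = (if u = v then 1 else 0)) \<and>
     (\<forall>x. (\<forall>u\<in>B. x \<bullet> u = 0) \<longleftrightarrow> x = 0))"

instance
proof
  have *: "finite (Basis :: 'a symmat set) \<and> (Basis :: 'a symmat set) \<noteq> {} \<and>
      (\<forall>u\<in>Basis. \<forall>v\<in>Basis. u \<bullet> (v :: 'a symmat) = (if u = v then 1 else 0)) \<and>
      (\<forall>x :: 'a symmat. (\<forall>u\<in>Basis. x \<bullet> u = 0) \<longleftrightarrow> x = 0)"
    unfolding Basis_symmat_def by (rule someI_ex [OF symmat_orthonormal_basis])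
  show "(Basis :: 'a symmat set) \<noteq> {}"
    using * by (elim conjE)
  show "finite (Basis :: 'a symmat set)"
    using * by (elim conjE)
  show "u \<bullet> v = (if u = v then 1 else 0)" if "u \<in> Basis" "v \<in> Basis" for u v :: "'a symmat"
    using * that by (elim conjE) (drule (1) bspec, drule (1) bspec)
  show "(\<forall>u\<in>Basis. x \<bullet> u = 0) \<longleftrightarrow> x = 0" for x :: "'a symmat"
    using * by (elim conjE) (rule spec)
qed

end

definition Gr :: "nat \<Rightarrow> 'n::finite symmat set" where
  "Gr q = {R. \<exists>S :: (real ^ 'n) set. subspace S \<and> dim S = q \<and>
     (\<forall>x. mat_of R *v x \<in> S \<and> (\<forall>y\<in>S. orthogonal (x - mat_of R *v x) y))}"

definition char_pol :: "real ^ 'n ^ 'n::finite \<Rightarrow> real poly" where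
  "char_pol A = det (\<chi> i j. (if i = j then [:0, 1:] else 0) - [:A $ i $ j:])"

text \<open>
  \<open>eigval k A\<close> is the \<open>k\<close>-th largest eigenvalue, counted with multiplicity and with \<open>k\<close> starting
  from 1. It is intended for symmetric \<open>A\<close>, where all \<open>CARD('n)\<close> eigenvalues are real.
\<close>

definition eigval :: "nat \<Rightarrow> real ^ 'n ^ 'n::finite \<Rightarrow> real" where
  "eigval k A = rev (sorted_list_of_multiset (proots (char_pol A))) ! (k - 1)"

definition C1_on :: "('a::real_normed_vector \<Rightarrow> 'b::real_normed_vector) \<Rightarrow> 'a set \<Rightarrow> bool" where
  "C1_on f U \<longleftrightarrow> (\<exists>f' :: 'a \<Rightarrow> 'a \<Rightarrow>\<^sub>L 'b.
     (\<forall>x\<in>U. (f has_derivative blinfun_apply (f' x)) (at x)) \<and> continuous_on U f')"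

definition tilt_argmin ::
    "'a::euclidean_space set \<Rightarrow> ('a \<Rightarrow> real) \<Rightarrow> 'a \<Rightarrow> real \<Rightarrow> 'a \<Rightarrow> 'a set" where
  "tilt_argmin M f \<beta>\<^sub>0 \<epsilon> v =
     {\<beta>. is_arg_min (\<lambda>\<beta>. f \<beta> - v \<bullet> \<beta>) (\<lambda>\<beta>. \<beta> \<in> M \<inter> cball \<beta>\<^sub>0 \<epsilon>) \<beta>}"

text \<open>
  \<open>tilt_map M f \<beta>\<^sub>0 \<sigma>\<close> says that near the origin the solution map of the tilted problems is
  single-valued and \<open>C\<^sup>1\<close>, and is given there by \<open>\<sigma>\<close>; the values of \<open>\<sigma>\<close> elsewhere are irrelevant.
\<close>

definition tilt_map ::
    "'a::euclidean_space set \<Rightarrow> ('a \<Rightarrow> real) \<Rightarrow> 'a \<Rightarrow> ('a \<Rightarrow> 'a) \<Rightarrow> bool" where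
  "tilt_map M f \<beta>\<^sub>0 \<sigma> \<longleftrightarrow>
     (\<exists>\<epsilon>>0. \<exists>U. open U \<and> 0 \<in> U \<and> (\<forall>v\<in>U. tilt_argmin M f \<beta>\<^sub>0 \<epsilon> v = {\<sigma> v}) \<and>
        \<sigma> 0 = \<beta>\<^sub>0 \<and> C1_on \<sigma> U)"

definition tilt_stable :: "'a::euclidean_space set \<Rightarrow> ('a \<Rightarrow> real) \<Rightarrow> 'a \<Rightarrow> bool" where
  "tilt_stable M f \<beta>\<^sub>0 \<longleftrightarrow> is_arg_min f (\<lambda>\<beta>. \<beta> \<in> M) \<beta>\<^sub>0 \<and> (\<exists>\<sigma>. tilt_map M f \<beta>\<^sub>0 \<sigma>)"

definition unstable :: "'a::euclidean_space set \<Rightarrow> ('a \<Rightarrow> real) \<Rightarrow> 'a \<Rightarrow> bool" where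
  "unstable M f \<beta>\<^sub>0 \<longleftrightarrow> is_arg_min f (\<lambda>\<beta>. \<beta> \<in> M) \<beta>\<^sub>0 \<and> \<not> tilt_stable M f \<beta>\<^sub>0"

text \<open>Any two choices of \<open>\<sigma>\<close> agree near the origin, so the derivative below does not depend on \<open>SOME\<close>.\<close>

definition reg_modulus :: "'a::euclidean_space set \<Rightarrow> ('a \<Rightarrow> real) \<Rightarrow> 'a \<Rightarrow> ereal" where
  "reg_modulus M f \<beta>\<^sub>0 =
     (if tilt_stable M f \<beta>\<^sub>0
      then ereal (onorm (frechet_derivative (SOME \<sigma>. tilt_map M f \<beta>\<^sub>0 \<sigma>) (at 0)))
      else \<infinity>)"

definition centered_measures :: "'a::euclidean_space measure set" where
  "centered_measures =
     {\<mu>. prob_space \<mu> \<and> sets \<mu> = sets borel \<and> integrable \<mu> (\<lambda>x. (norm x)\<^sup>2) \<and> (LINT x|\<mu>. x) = 0}"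

definition couplings ::
    "'a::euclidean_space measure \<Rightarrow> 'a measure \<Rightarrow> ('a \<times> 'a) measure set" where
  "couplings \<mu> \<nu> =
     {\<pi>. prob_space \<pi> \<and> sets \<pi> = sets borel \<and> distr \<pi> borel fst = \<mu> \<and> distr \<pi> borel snd = \<nu>}"

text \<open>
  For measures with finite second moment, the only ones considered, every coupling has finite cost
  and the infimum is over a nonempty set and attained.
\<close>

definition W2 :: "'a::euclidean_space measure \<Rightarrow> 'a measure \<Rightarrow> real" where
  "W2 \<mu> \<nu> = (INF \<pi>\<in>couplings \<mu> \<nu>. sqrt (LINT z|\<pi>. (norm (fst z - snd z))\<^sup>2))"

definition W2_set :: "'a::euclidean_space measure \<Rightarrow> 'a measure set \<Rightarrow> real" where
  "W2_set \<mu> E = (INF \<nu>\<in>E. W2 \<mu> \<nu>)"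

definition second_moment_matrix :: "(real ^ 'n) measure \<Rightarrow> real ^ 'n ^ 'n::finite" where
  "second_moment_matrix \<mu> = (\<chi> i j. LINT x|\<mu>. x $ i * x $ j)"

definition pca_objective :: "(real ^ 'n) measure \<Rightarrow> 'n::finite symmat \<Rightarrow> real" where
  "pca_objective \<mu> R = (LINT x|\<mu>. (norm (mat_of R *v x))\<^sup>2)"

definition pca_maximizer :: "nat \<Rightarrow> (real ^ 'n) measure \<Rightarrow> 'n::finite symmat \<Rightarrow> bool" where
  "pca_maximizer q \<mu> R \<longleftrightarrow> is_arg_max (pca_objective \<mu>) (\<lambda>R. R \<in> Gr q) R"

definition pca_exceptional :: "nat \<Rightarrow> (real ^ 'n::finite) measure set" where
  "pca_exceptional q =
     {\<mu> \<in> centered_measures.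
        \<exists>R. pca_maximizer q \<mu> R \<and> unstable (Gr q) (\<lambda>R. - pca_objective \<mu> R) R}"

text \<open>
  The maximizer is unique when it is stable. When it is not unique, all maximizers are unstable and
  each of them gives the value \<open>\<infinity>\<close>.
\<close>

definition pca_REG :: "nat \<Rightarrow> (real ^ 'n::finite) measure \<Rightarrow> ereal" where
  "pca_REG q \<mu> = reg_modulus (Gr q) (\<lambda>R. - pca_objective \<mu> R) (SOME R. pca_maximizer q \<mu> R)"

definition pca_RSE :: "nat \<Rightarrow> (real ^ 'n::finite) measure \<Rightarrow> real" where
  "pca_RSE q \<mu> = W2_set \<mu> (pca_exceptional q)"

end

theory Submission
  imports Defs
begin

text \<open>
  On the Grassmannian the objective is \<open>\<langle>\<Sigma>, R\<rangle>\<close>, so the tilted problem maximizes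
  \<open>\<langle>\<Sigma> + v, R\<rangle>\<close> and its solution is the projection onto the top \<open>q\<close> eigenvectors of
  \<open>\<Sigma> + v\<close>. If \<open>\<lambda>\<^sub>q > \<lambda>\<^sub>q\<^sub>+\<^sub>1\<close>, this projection is \<open>C\<^sup>1\<close> in \<open>v\<close> with derivative of norm
  \<open>1 / (\<lambda>\<^sub>q - \<lambda>\<^sub>q\<^sub>+\<^sub>1)\<close>; if \<open>\<lambda>\<^sub>q = \<lambda>\<^sub>q\<^sub>+\<^sub>1\<close>, rotating the \<open>q\<close>-th eigenvector towards the next one
  gives further maximizers arbitrarily close by. Hence the exceptional set is
  \<open>{\<mu>. \<lambda>\<^sub>q = \<lambda>\<^sub>q\<^sub>+\<^sub>1}\<close>. Reaching it costs at least \<open>(a - b)\<^sup>2 / 2\<close>, with \<open>a\<^sup>2 = \<lambda>\<^sub>q\<close> and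
  \<open>b\<^sup>2 = \<lambda>\<^sub>q\<^sub>+\<^sub>1\<close>, because a coupling has to move the standard deviations in two orthogonal directions
  to a common value; moving both to \<open>(a + b) / 2\<close> attains the bound.
\<close>

section \<open>Orthonormal families and the spectral theorem\<close>

text \<open>Tilts range over all symmetric matrices, so a tilted problem is again a trace
  maximization, and calculus on the manifold is avoided. Smoothness is the harder half of stability:
  eigenvectors chosen for \<open>S + v\<close> need not depend continuously on \<open>v\<close>, so
  only the spectral projections are compared. Quadratic growth makes them Lipschitz; algebra in the
  eigenbasis upgrades this to a quadratic remainder with one constant for all base points near 0,
  and such a bound gives differentiability and continuity of the derivative together. The distance
  bound must cope with measures whose second moments do not commute with those of \<open>D\<close>.
  Dimension counting finds directions that lie at once in a spectral subspace of each of the two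
  matrices, and each direction then pays its own difference of standard deviations whatever the
  coupling is. In the converse, a coordinate of zero variance may sit on an atom of \<open>D\<close>
  that no map can spread out, which is why the construction passes to a product with a fair
  coin.\<close>

definition orthonormal :: "(nat \<Rightarrow> real ^ 'n::finite) \<Rightarrow> nat \<Rightarrow> bool" where
  "orthonormal e m \<longleftrightarrow> (\<forall>i<m. \<forall>j<m. e i \<bullet> e j = (if i = j then 1 else 0))"

lemma orthonormalD:
  "orthonormal e m \<Longrightarrow> i < m \<Longrightarrow> j < m \<Longrightarrow> e i \<bullet> e j = (if i = j then 1 else 0)"
  by (simp add: orthonormal_def)

lemma orthonormal_norm: "orthonormal e m \<Longrightarrow> i < m \<Longrightarrow> norm (e i) = 1"
  by (simp add: orthonormal_def norm_eq_1)

lemma orthonormal_mono: "orthonormal e m \<Longrightarrow> k \<le> m \<Longrightarrow> orthonormal e k"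
  by (simp add: orthonormal_def)

lemma orthonormal_inj:
  assumes "orthonormal e m" shows "inj_on e {..<m}"
proof (rule inj_onI)
  fix i j assume "i \<in> {..<m}" "j \<in> {..<m}" "e i = e j"
  then show "i = j"
    using orthonormalD[OF assms, of i j] orthonormalD[OF assms, of i i] by (auto split: if_splits)
qed

lemma orthonormal_independent:
  assumes "orthonormal e m" shows "independent (e ` {..<m})"
proof (rule pairwise_orthogonal_independent)
  show "pairwise orthogonal (e ` {..<m})"
    using orthonormalD[OF assms] by (auto simp: pairwise_def orthogonal_def split: if_splits)
  show "0 \<notin> e ` {..<m}"
    using orthonormal_norm[OF assms] by auto (metis norm_zero zero_neq_one)
qed

lemma orthonormal_dim:
  assumes "orthonormal e m" "I \<subseteq> {..<m}" shows "dim (span (e ` I)) = card I"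
proof -
  have "independent (e ` I)"
    using orthonormal_independent[OF assms(1)] assms(2) by (meson image_mono independent_mono)
  then have "dim (e ` I) = card (e ` I)" by (simp add: dim_eq_card_independent)
  also have "\<dots> = card I"
    using orthonormal_inj[OF assms(1)] assms(2) by (simp add: card_image inj_on_subset)
  finally show ?thesis by simp
qed

text \<open>The residual \<open>z\<close> lies in the span and is orthogonal to its generators,
  hence to itself.\<close>

lemma orthonormal_expand_span:
  assumes e: "orthonormal e m" and I: "I \<subseteq> {..<m}" and x: "x \<in> span (e ` I)"
  shows "x = (\<Sum>i\<in>I. (e i \<bullet> x) *\<^sub>R e i)"
proof -
  have fin: "finite I" using I finite_subset by blast
  define z where "z = x - (\<Sum>i\<in>I. (e i \<bullet> x) *\<^sub>R e i)"
  have zin: "z \<in> span (e ` I)"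
    unfolding z_def by (intro span_diff x span_sum span_scale span_base) auto
  have "orthogonal z y" if y: "y \<in> e ` I" for y
  proof -
    obtain j where j: "j \<in> I" "y = e j" using y by blast
    have "(\<Sum>i\<in>I. (e i \<bullet> x) * (e i \<bullet> e j)) = (\<Sum>i\<in>I. if i = j then e j \<bullet> x else 0)"
      by (rule sum.cong) (use orthonormalD[OF e] I j in \<open>auto simp: subset_iff\<close>)
    then show ?thesis
      using j fin inner_commute[of x "e j"] by (simp add: z_def orthogonal_def inner_diff_left inner_sum_left)
  qed
  then have "orthogonal z z" by (metis orthogonal_to_span zin)
  then show ?thesis by (simp add: orthogonal_def z_def)
qed

lemma orthonormal_span_UNIV:
  fixes e :: "nat \<Rightarrow> real ^ 'n::finite"
  assumes e: "orthonormal e CARD('n)"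
  shows "span (e ` {..<CARD('n)}) = UNIV"
proof -
  have "dim (span (e ` {..<CARD('n)})) = DIM(real ^ 'n)"
    using orthonormal_dim[OF e, of "{..<CARD('n)}"] by simp
  then show ?thesis using dim_eq_full by (metis span_span)
qed

lemma orthonormal_expand:
  fixes e :: "nat \<Rightarrow> real ^ 'n::finite"
  assumes e: "orthonormal e CARD('n)"
  shows "x = (\<Sum>i<CARD('n). (e i \<bullet> x) *\<^sub>R e i)"
  using orthonormal_expand_span[OF e order_refl] orthonormal_span_UNIV[OF e] by simp

lemma parseval:
  fixes e :: "nat \<Rightarrow> real ^ 'n::finite"
  assumes e: "orthonormal e CARD('n)"
  shows "x \<bullet> y = (\<Sum>i<CARD('n). (e i \<bullet> x) * (e i \<bullet> y))"
proof -
  have "x \<bullet> y = (\<Sum>i<CARD('n). (e i \<bullet> x) *\<^sub>R e i) \<bullet> y"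
    using orthonormal_expand[OF e, of x] by simp
  then show ?thesis by (simp add: inner_sum_left)
qed

text \<open>The family may be incomplete; the deficit is the squared norm of the residual
  \<open>x - p\<close>.\<close>

lemma bessel:
  assumes e: "orthonormal e m"
  shows "(\<Sum>i<m. (e i \<bullet> x)\<^sup>2) \<le> (norm x)\<^sup>2"
proof -
  define p where "p = (\<Sum>i<m. (e i \<bullet> x) *\<^sub>R e i)"
  have xp: "x \<bullet> p = (\<Sum>i<m. (e i \<bullet> x)\<^sup>2)"
    by (simp add: p_def inner_sum_right power2_eq_square inner_commute)
  have ep: "e i \<bullet> p = e i \<bullet> x" if "i < m" for i
  proof -
    have "(\<Sum>j<m. (e j \<bullet> x) * (e i \<bullet> e j)) = (\<Sum>j<m. if j = i then e i \<bullet> x else 0)"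
      by (rule sum.cong) (use orthonormalD[OF e] that in auto)
    then show ?thesis using that by (simp add: p_def inner_sum_right)
  qed
  have "p \<bullet> p = (\<Sum>i<m. (e i \<bullet> x) * (e i \<bullet> p))"
    by (subst p_def) (simp add: inner_sum_left)
  also have "\<dots> = (\<Sum>i<m. (e i \<bullet> x)\<^sup>2)"
    using ep by (simp add: power2_eq_square)
  finally have pp: "p \<bullet> p = (\<Sum>i<m. (e i \<bullet> x)\<^sup>2)" .
  have "0 \<le> (x - p) \<bullet> (x - p)" by simp
  then show ?thesis
    using xp pp by (simp add: inner_diff_left inner_diff_right inner_commute power2_norm_eq_inner)
qed

lemma subspace_orthonormal:
  fixes S :: "(real ^ 'n::finite) set"
  assumes "subspace S"
  obtains b where "orthonormal b (dim S)" "span (b ` {..<dim S}) = S"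
proof -
  obtain B where B: "B \<subseteq> S" "pairwise orthogonal B" "\<And>x. x \<in> B \<Longrightarrow> norm x = 1"
    "independent B" "card B = dim S" "span B = S"
    using orthonormal_basis_subspace[OF assms] by metis
  have "finite B" using B(4) independent_imp_finite by blast
  then obtain h where h: "bij_betw h {..<dim S} B"
    using ex_bij_betw_nat_finite[of B] B(5) by (auto simp: atLeast0LessThan)
  have "orthonormal h (dim S)"
    unfolding orthonormal_def
  proof (intro allI impI)
    fix i j assume ij: "i < dim S" "j < dim S"
    then have hB: "h i \<in> B" "h j \<in> B" using h by (auto simp: bij_betw_def)
    show "h i \<bullet> h j = (if i = j then 1 else 0)"
    proof (cases "i = j")
      case True
      then show ?thesis using B(3)[OF hB(1)] by (simp add: norm_eq_1)
    next
      case False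
      then have "h i \<noteq> h j" using h ij by (auto simp: bij_betw_def inj_on_def)
      then show ?thesis using B(2) hB False by (auto simp: pairwise_def orthogonal_def)
    qed
  qed
  moreover have "span (h ` {..<dim S}) = S" using h B(6) by (simp add: bij_betw_def)
  ultimately show ?thesis using that by blast
qed

section \<open>Spectral theorem by maximizing the quadratic form\<close>

lemma sym_matrix_inner:
  fixes A :: "real ^ 'n ^ 'n::finite"
  assumes "transpose A = A"
  shows "(A *v x) \<bullet> y = x \<bullet> (A *v y)"
  by (metis assms dot_lmul_matrix transpose_matrix_vector)

text \<open>First-order optimality without derivatives: moving from \<open>u\<close> along the
  residual \<open>w = A u - c u\<close> gains \<open>2 t |w|^2\<close> against a second-order term
  \<open>t^2 K\<close>, which is impossible for small \<open>t > 0\<close> unless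
  \<open>w = 0\<close>.\<close>

lemma max_quadratic_form_eigenvector:
  fixes A :: "real ^ 'n ^ 'n::finite"
  assumes sym: "transpose A = A" and S: "subspace S" and inv: "\<forall>x\<in>S. A *v x \<in> S"
    and u: "u \<in> S" "norm u = 1"
    and max: "\<And>x. x \<in> S \<Longrightarrow> norm x = 1 \<Longrightarrow> x \<bullet> (A *v x) \<le> u \<bullet> (A *v u)"
  shows "A *v u = (u \<bullet> (A *v u)) *\<^sub>R u"
proof -
  define c where "c = u \<bullet> (A *v u)"
  define w where "w = A *v u - c *\<^sub>R u"
  have uu: "u \<bullet> u = 1" using u by (simp add: norm_eq_1)
  have w: "w \<in> S" unfolding w_def using S inv u by (simp add: subspace_diff subspace_scale)
  have wu: "w \<bullet> u = 0"
    using inner_commute[of u "A *v u"] by (simp add: w_def inner_diff_left uu c_def)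
  have wAu: "w \<bullet> (A *v u) = w \<bullet> w"
    using wu by (simp add: w_def inner_diff_right)
  have le: "x \<bullet> (A *v x) \<le> c * (x \<bullet> x)" if "x \<in> S" for x
  proof (cases "x = 0")
    case False
    define y where "y = x /\<^sub>R norm x"
    have "y \<bullet> (A *v y) \<le> c"
      unfolding c_def by (rule max) (use that S False in \<open>auto simp: y_def subspace_scale\<close>)
    moreover have "x \<bullet> (A *v x) = (norm x)\<^sup>2 * (y \<bullet> (A *v y))"
      using False by (simp add: y_def matrix_vector_mult_scaleR power2_eq_square field_simps)
    ultimately show ?thesis
      by (simp add: power2_norm_eq_inner mult.commute[of c] mult_left_mono)
  qed simp
  define K where "K = c * (w \<bullet> w) - w \<bullet> (A *v w)"
  have quad: "2 * t * (w \<bullet> w) \<le> t\<^sup>2 * K" for t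
  proof -
    have uAw: "u \<bullet> (A *v w) = w \<bullet> w"
      using sym_matrix_inner[OF sym, of u w] wAu by (simp add: inner_commute)
    have uw: "u \<bullet> w = 0" using wu by (simp add: inner_commute)
    have "u + t *\<^sub>R w \<in> S" using S u w by (simp add: subspace_add subspace_scale)
    from le[OF this] show ?thesis
      using uAw wAu wu uw uu
      by (simp add: matrix_vector_right_distrib matrix_vector_mult_scaleR inner_add_left
          inner_add_right K_def c_def[symmetric] algebra_simps power2_eq_square)
  qed
  have "w \<bullet> w = 0"
  proof (rule ccontr)
    assume ne: "w \<bullet> w \<noteq> 0"
    then have pos: "w \<bullet> w > 0" by simp
    show False
    proof (cases "K > 0")
      case True
      have "2 * (w \<bullet> w / K) * (w \<bullet> w) \<le> (w \<bullet> w / K)\<^sup>2 * K" by (rule quad)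
      then have "2 * (w \<bullet> w)\<^sup>2 / K \<le> (w \<bullet> w)\<^sup>2 / K" using True
        by (simp add: power2_eq_square field_simps)
      then have "(w \<bullet> w)\<^sup>2 / K \<le> 0" by simp
      moreover have "(w \<bullet> w)\<^sup>2 / K > 0" using True pos by simp
      ultimately show False by linarith
    next
      case False
      then show False using quad[of 1] pos by simp
    qed
  qed
  then show ?thesis by (simp add: w_def c_def)
qed

text \<open>Induction over arbitrary invariant subspaces, so that the orthogonal complement of one
  eigenvector inside \<open>S\<close> is again an instance. Splitting off the maximizer of the
  quadratic form at each stage delivers the eigenvalues in decreasing order.\<close>

lemma spectral_invariant_subspace:
  fixes A :: "real ^ 'n ^ 'n::finite"
  assumes sym: "transpose A = A"
  shows "subspace S \<Longrightarrow> \<forall>x\<in>S. A *v x \<in> S \<Longrightarrow> dim S = m \<Longrightarrow>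
    \<exists>e l. orthonormal e m \<and> (\<forall>i<m. e i \<in> S \<and> A *v e i = l i *\<^sub>R e i) \<and>
      (\<forall>i j. i \<le> j \<longrightarrow> j < m \<longrightarrow> l j \<le> (l i :: real))"
proof (induction m arbitrary: S)
  case 0
  show ?case by (simp add: orthonormal_def)
next
  case (Suc m)
  note S = Suc.prems(1) and inv = Suc.prems(2)
  let ?K = "S \<inter> sphere 0 1"
  have "compact ?K" using S by (simp add: closed_Int_compact closed_subspace)
  moreover have "?K \<noteq> {}"
  proof -
    obtain x where x: "x \<in> S" "x \<noteq> 0"
      using Suc.prems(3) by (metis dim_eq_0 nat.distinct(1) subset_singletonD singleton_iff subsetI)
    then have "x /\<^sub>R norm x \<in> ?K" using S by (simp add: subspace_scale)
    then show ?thesis by blast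
  qed
  moreover have "continuous_on ?K (\<lambda>x. x \<bullet> (A *v x))"
    by (intro continuous_intros matrix_vector_mult_linear_continuous_on linear_continuous_on)
      (simp add: matrix_vector_mul_bounded_linear)
  ultimately obtain u where u: "u \<in> ?K" and max: "\<forall>x\<in>?K. x \<bullet> (A *v x) \<le> u \<bullet> (A *v u)"
    using continuous_attains_sup[of ?K "\<lambda>x. x \<bullet> (A *v x)"] by blast
  define c where "c = u \<bullet> (A *v u)"
  have uS: "u \<in> S" "norm u = 1" using u by auto
  have Au: "A *v u = c *\<^sub>R u"
    unfolding c_def by (rule max_quadratic_form_eigenvector[OF sym S inv uS]) (use max in auto)
  have uu: "u \<bullet> u = 1" using uS by (simp add: norm_eq_1)
  define T where "T = {y \<in> S. \<forall>x\<in>span {u}. orthogonal x y}"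
  have T: "T = {y \<in> S. u \<bullet> y = 0}"
    unfolding T_def by (auto simp: span_singleton orthogonal_def)
  have "dim T + dim (span {u}) = dim S"
    unfolding T_def by (rule dim_subspace_orthogonal_to_vectors) (use S uS in \<open>auto simp: span_minimal\<close>)
  moreover have "dim (span {u}) = 1"
    using uS by (metis dim_singleton dim_span norm_zero zero_neq_one)
  ultimately have dimT: "dim T = m" using Suc.prems(3) by simp
  have subT: "subspace T"
    using S unfolding T by (auto simp: subspace_def inner_add_right)
  have invT: "\<forall>x\<in>T. A *v x \<in> T"
  proof
    fix x assume x: "x \<in> T"
    then have "u \<bullet> (A *v x) = 0"
      using sym_matrix_inner[OF sym, of u x] by (simp add: T Au)
    then show "A *v x \<in> T" using x inv by (simp add: T)
  qed
  obtain e l where e: "orthonormal e m" and el: "\<And>i. i < m \<Longrightarrow> e i \<in> T \<and> A *v e i = l i *\<^sub>R e i"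
    and l: "\<And>i j. i \<le> j \<Longrightarrow> j < m \<Longrightarrow> l j \<le> (l i :: real)"
    using Suc.IH[OF subT invT dimT] by blast
  have lc: "l i \<le> c" if "i < m" for i
  proof -
    have "e i \<bullet> (A *v e i) \<le> c"
      unfolding c_def
      by (rule max[rule_format]) (use el[OF that] orthonormal_norm[OF e that] in \<open>simp add: T\<close>)
    then show ?thesis using el[OF that] orthonormalD[OF e that that] by simp
  qed
  define e' where "e' = case_nat u e"
  define l' where "l' = case_nat c l"
  have "orthonormal e' (Suc m)"
    unfolding orthonormal_def e'_def using orthonormalD[OF e] el uu
    by (auto split: nat.splits simp: T inner_commute)
  moreover have "e' i \<in> S \<and> A *v e' i = l' i *\<^sub>R e' i" if "i < Suc m" for i
    using that uS Au el by (auto simp: e'_def l'_def T split: nat.splits)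
  moreover have "l' j \<le> l' i" if "i \<le> j" "j < Suc m" for i j
    using that l lc by (auto simp: l'_def split: nat.splits)
  ultimately show ?case by blast
qed

text \<open>Indices start at 0, so \<open>l (q - 1)\<close> and \<open>l q\<close> are \<open>\<lambda>\<^sub>q\<close> and \<open>\<lambda>\<^sub>q\<^sub>+\<^sub>1\<close>.\<close>

definition eigensystem :: "real ^ 'n ^ 'n::finite \<Rightarrow> (nat \<Rightarrow> real ^ 'n) \<Rightarrow> (nat \<Rightarrow> real) \<Rightarrow> bool" where
  "eigensystem A e l \<longleftrightarrow> orthonormal e CARD('n) \<and> (\<forall>i<CARD('n). A *v e i = l i *\<^sub>R e i) \<and>
     (\<forall>i j. i \<le> j \<longrightarrow> j < CARD('n) \<longrightarrow> l j \<le> l i)"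

lemma eigensystemD:
  fixes A :: "real ^ 'n ^ 'n::finite"
  assumes "eigensystem A e l"
  shows "orthonormal e CARD('n)" "\<And>i. i < CARD('n) \<Longrightarrow> A *v e i = l i *\<^sub>R e i"
    "\<And>i j. i \<le> j \<Longrightarrow> j < CARD('n) \<Longrightarrow> l j \<le> l i"
  using assms by (auto simp: eigensystem_def)

theorem eigensystem_exists:
  fixes A :: "real ^ 'n ^ 'n::finite"
  assumes "transpose A = A"
  obtains e l where "eigensystem A e l"
  using spectral_invariant_subspace[OF assms subspace_UNIV, of "CARD('n)"]
  by (auto simp: eigensystem_def)

section \<open>Eigenvalues as roots of the characteristic polynomial\<close>

lemma poly_char_pol: "poly (char_pol A) x = det (mat x - A)" for A :: "real ^ 'n ^ 'n::finite"
  unfolding char_pol_def det_def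
  by (auto simp: poly_sum poly_prod mat_def intro!: sum.cong prod.cong)

text \<open>With the eigenvectors as rows of \<open>P\<close>, the product of \<open>P\<close> and
  \<open>mat x - A\<close> is \<open>P\<close> with scaled rows, so \<open>det P\<close> cancels.
  Equality at every real \<open>x\<close> gives equality of polynomials.\<close>

lemma char_pol_eigensystem:
  fixes A :: "real ^ 'n ^ 'n::finite"
  assumes A: "transpose A = A" and el: "eigensystem A e l"
  shows "char_pol A = (\<Prod>i<CARD('n). [:- l i, 1:])"
proof -
  note e = eigensystemD[OF el]
  obtain idx where idx: "bij_betw idx (UNIV :: 'n set) {..<CARD('n)}"
    using ex_bij_betw_finite_nat[of "UNIV :: 'n set"] by (auto simp: atLeast0LessThan)
  have idx_lt: "idx i < CARD('n)" for i using idx by (auto simp: bij_betw_def)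
  define P :: "real ^ 'n ^ 'n" where "P = (\<chi> i. e (idx i))"
  have "P ** transpose P = mat 1"
    using orthonormalD[OF e(1) idx_lt idx_lt] idx
    by (auto simp: P_def matrix_matrix_mult_def transpose_def mat_def vec_eq_iff inner_vec_def
        bij_betw_def inj_on_def split: if_splits)
  then have detP: "det P \<noteq> 0"
    by (metis det_I det_mul mult_zero_left zero_neq_one)
  have "poly (char_pol A) x = poly (\<Prod>i<CARD('n). [:- l i, 1:]) x" for x
  proof -
    have "P ** (mat x - A) = (\<chi> i. (x - l (idx i)) *s P $ i)"
    proof (subst vec_eq_iff, intro allI)
      fix i
      have "(P ** (mat x - A)) $ i = transpose (mat x - A) *v P $ i"
        by (simp add: matrix_matrix_mult_def transpose_def matrix_vector_mult_def vec_eq_iff mult.commute)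
      also have "transpose (mat x - A) = mat x - A"
        using A by (auto simp: transpose_def mat_def vec_eq_iff)
      also have "(mat x - A) *v P $ i = (x - l (idx i)) *s P $ i"
      proof -
        have "mat x *v P $ i = x *s P $ i"
          by (simp add: mat_def matrix_vector_mult_def vec_eq_iff if_distrib[of "\<lambda>y. y * _"]
              cong: if_cong)
        then show ?thesis
          using e(2)[OF idx_lt, of i]
          by (simp add: matrix_vector_mult_diff_rdistrib P_def scalar_mult_eq_scaleR algebra_simps)
      qed
      finally show "(P ** (mat x - A)) $ i = (\<chi> i. (x - l (idx i)) *s P $ i) $ i" by simp
    qed
    then have "det P * det (mat x - A) = (\<Prod>i\<in>UNIV. x - l (idx i)) * det P"
      using det_rows_mul[of "\<lambda>i. x - l (idx i)" "\<lambda>i. P $ i"] by (metis det_mul vec_nth_inverse)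
    then have "det (mat x - A) = (\<Prod>i\<in>UNIV. x - l (idx i))" using detP by simp
    also have "\<dots> = (\<Prod>i<CARD('n). x - l i)" by (rule prod.reindex_bij_betw[OF idx])
    finally show ?thesis by (simp add: poly_char_pol poly_prod)
  qed
  then show ?thesis using poly_eq_poly_eq_iff by blast
qed

text \<open>Makes the numbers of an eigensystem independent of the chosen basis. The shift arises
  because \<open>eigval\<close> counts from 1 and \<open>l\<close> from 0.\<close>

lemma eigval_eigensystem:
  fixes A :: "real ^ 'n ^ 'n::finite"
  assumes A: "transpose A = A" and el: "eigensystem A e l" and k: "k < CARD('n)"
  shows "eigval (Suc k) A = l k"
proof -
  have "proots (char_pol A) = (\<Sum>i<CARD('n). {#l i#})"
    unfolding char_pol_eigensystem[OF A el] by (subst proots_prod) auto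
  also have "\<dots> = mset (rev (map l [0..<CARD('n)]))"
  proof -
    have "(\<Sum>i<m. {#l i#}) = mset (rev (map l [0..<m]))" for m by (induction m) auto
    then show ?thesis .
  qed
  finally have pr: "proots (char_pol A) = mset (rev (map l [0..<CARD('n)]))" .
  have "sorted (rev (map l [0..<CARD('n)]))"
    using eigensystemD(3)[OF el] by (auto simp: sorted_rev_iff_nth_mono)
  then have "sorted_list_of_multiset (proots (char_pol A)) = rev (map l [0..<CARD('n)])"
    by (simp only: pr sorted_list_of_multiset_mset) (rule sorted_sort_id)
  then show ?thesis using k by (simp add: eigval_def)
qed

section \<open>Orthogonal projections and the quadratic growth of PCA\<close>

lemma symmat_inner_vec: "(mat_of A *v x) \<bullet> y = x \<bullet> (mat_of A *v y)"
  by (rule sym_matrix_inner) simp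

lemma symmat_eqI: "(\<And>x. mat_of A *v x = mat_of B *v x) \<Longrightarrow> A = B"
  by (simp add: symmat_eq_iff matrix_eq)

text \<open>Basis independence of the trace inner product: expand every row of both matrices by
  Parseval and exchange the sums.\<close>

lemma symmat_inner_orthonormal:
  fixes A B :: "'n::finite symmat"
  assumes e: "orthonormal e CARD('n)"
  shows "A \<bullet> B = (\<Sum>k<CARD('n). (mat_of A *v e k) \<bullet> (mat_of B *v e k))"
proof -
  have "A \<bullet> B = (\<Sum>i\<in>UNIV. (mat_of A $ i) \<bullet> (mat_of B $ i))"
    by (simp add: inner_symmat_eq inner_vec_def)
  also have "\<dots> = (\<Sum>i\<in>UNIV. \<Sum>k<CARD('n). (e k \<bullet> mat_of A $ i) * (e k \<bullet> mat_of B $ i))"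
    by (simp add: parseval[OF e, of "mat_of A $ _"])
  also have "\<dots> = (\<Sum>k<CARD('n). \<Sum>i\<in>UNIV. (e k \<bullet> mat_of A $ i) * (e k \<bullet> mat_of B $ i))"
    by (rule sum.swap)
  also have "\<dots> = (\<Sum>k<CARD('n). (mat_of A *v e k) \<bullet> (mat_of B *v e k))"
    by (simp add: inner_vec_def[of "_ *v _"] matrix_vector_mul_component inner_commute)
  finally show ?thesis .
qed

lemma symmat_norm_orthonormal:
  fixes A :: "'n::finite symmat"
  assumes e: "orthonormal e CARD('n)"
  shows "(norm A)\<^sup>2 = (\<Sum>k<CARD('n). \<Sum>i<CARD('n). (e i \<bullet> (mat_of A *v e k))\<^sup>2)"
proof -
  have "(norm A)\<^sup>2 = (\<Sum>k<CARD('n). (mat_of A *v e k) \<bullet> (mat_of A *v e k))"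
    by (simp add: power2_norm_eq_inner symmat_inner_orthonormal[OF e])
  then show ?thesis by (simp add: parseval[OF e, of "_ *v _"] power2_eq_square)
qed

text \<open>The Frobenius norm dominates the operator norm, by Cauchy-Schwarz in every row.\<close>

lemma symmat_norm_mult_le: "norm (mat_of A *v x) \<le> norm A * norm x"
proof -
  have "(norm (mat_of A *v x))\<^sup>2 = (\<Sum>i\<in>UNIV. (mat_of A $ i \<bullet> x)\<^sup>2)"
    unfolding power2_norm_eq_inner
    by (simp add: inner_vec_def[of "_ *v _"] matrix_vector_mul_component power2_eq_square)
  also have "\<dots> \<le> (\<Sum>i\<in>UNIV. (norm (mat_of A $ i))\<^sup>2 * (norm x)\<^sup>2)"
    using Cauchy_Schwarz_ineq by (intro sum_mono) (simp add: power2_norm_eq_inner)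
  also have "\<dots> = (norm A)\<^sup>2 * (norm x)\<^sup>2"
    by (simp add: sum_distrib_right power2_norm_eq_inner inner_symmat_eq inner_vec_def[of "mat_of _"])
  finally show ?thesis by (simp add: power_mult_distrib[symmetric] power2_le_iff_abs_le)
qed

section \<open>Points of the Grassmannian as sums of rank-one projections\<close>

definition proj :: "(nat \<Rightarrow> real ^ 'n) \<Rightarrow> nat \<Rightarrow> 'n::finite symmat" where
  "proj b q = symm (\<chi> r s. \<Sum>j<q. b j $ r * b j $ s)"

lemma mat_of_proj: "mat_of (proj b q) = (\<chi> r s. \<Sum>j<q. b j $ r * b j $ s)"
  unfolding proj_def by (rule symm_inverse) (simp add: transpose_def vec_eq_iff mult.commute)

lemma proj_mult: "mat_of (proj b q) *v x = (\<Sum>j<q. (b j \<bullet> x) *\<^sub>R b j)"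
proof (subst vec_eq_iff, intro allI)
  fix r
  have "(mat_of (proj b q) *v x) $ r = (\<Sum>s\<in>UNIV. \<Sum>j<q. b j $ r * b j $ s * x $ s)"
    by (simp add: mat_of_proj matrix_vector_mult_def sum_distrib_right)
  also have "\<dots> = (\<Sum>j<q. \<Sum>s\<in>UNIV. b j $ r * b j $ s * x $ s)" by (rule sum.swap)
  also have "\<dots> = (\<Sum>j<q. (b j \<bullet> x) *\<^sub>R b j) $ r"
    by (simp add: inner_vec_def sum_distrib_right sum_distrib_left mult_ac)
  finally show "(mat_of (proj b q) *v x) $ r = (\<Sum>j<q. (b j \<bullet> x) *\<^sub>R b j) $ r" .
qed

lemma inner_proj:
  fixes A :: "'n::finite symmat"
  shows "A \<bullet> proj b q = (\<Sum>j<q. b j \<bullet> (mat_of A *v b j))"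
proof -
  have "A \<bullet> proj b q = (\<Sum>r\<in>UNIV. \<Sum>s\<in>UNIV. \<Sum>j<q. mat_of A $ r $ s * (b j $ r * b j $ s))"
    by (simp add: inner_symmat_eq inner_vec_def mat_of_proj sum_distrib_left)
  also have "\<dots> = (\<Sum>r\<in>UNIV. \<Sum>j<q. \<Sum>s\<in>UNIV. mat_of A $ r $ s * (b j $ r * b j $ s))"
    by (intro sum.cong refl sum.swap)
  also have "\<dots> = (\<Sum>j<q. \<Sum>r\<in>UNIV. \<Sum>s\<in>UNIV. mat_of A $ r $ s * (b j $ r * b j $ s))"
    by (rule sum.swap)
  also have "\<dots> = (\<Sum>j<q. b j \<bullet> (mat_of A *v b j))"
    by (simp add: inner_vec_def matrix_vector_mult_def sum_distrib_left mult_ac)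
  finally show ?thesis .
qed

text \<open>Trades the subspace in the definition for an orthonormal frame, after which the
  quantities on \<open>Gr q\<close> become finite sums over the frame. The frame is not unique, the
  matrix is.\<close>

lemma Gr_iff_proj:
  fixes R :: "'n::finite symmat"
  shows "R \<in> Gr q \<longleftrightarrow> (\<exists>b. orthonormal b q \<and> R = proj b q)"
proof
  assume "R \<in> Gr q"
  then obtain S where S: "subspace S" "dim S = q" and R: "\<And>x. mat_of R *v x \<in> S"
    and ort: "\<And>x y. y \<in> S \<Longrightarrow> orthogonal (x - mat_of R *v x) y"
    unfolding Gr_def by blast
  obtain b where b: "orthonormal b q" "span (b ` {..<q}) = S"
    using subspace_orthonormal[OF S(1)] S(2) by metis
  have "R = proj b q"
  proof (rule symmat_eqI)
    fix x
    have "b j \<bullet> (mat_of R *v x) = b j \<bullet> x" if "j < q" for j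
    proof -
      have "b j \<in> S" using b(2) that by (auto intro: span_base)
      from ort[OF this, of x] show ?thesis
        using inner_commute[of x "b j"] inner_commute[of "mat_of R *v x" "b j"]
        by (simp add: orthogonal_def inner_diff_left)
    qed
    then show "mat_of R *v x = mat_of (proj b q) *v x"
      using orthonormal_expand_span[OF b(1) order_refl, of "mat_of R *v x"] R[of x] b(2)
      by (simp add: proj_mult)
  qed
  then show "\<exists>b. orthonormal b q \<and> R = proj b q" using b by blast
next
  assume "\<exists>b. orthonormal b q \<and> R = proj b q"
  then obtain b where b: "orthonormal b q" and R: "R = proj b q" by blast
  have "mat_of R *v x \<in> span (b ` {..<q})" for x
    unfolding R proj_mult by (intro span_sum span_scale span_base) auto
  moreover have "orthogonal (x - mat_of R *v x) y" if y: "y \<in> span (b ` {..<q})" for x y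
  proof -
    have "orthogonal (x - mat_of R *v x) z" if z: "z \<in> b ` {..<q}" for z
    proof -
      obtain i where i: "i < q" "z = b i" using z by blast
      have "(\<Sum>j<q. (b j \<bullet> x) * (b j \<bullet> b i)) = (\<Sum>j<q. if j = i then b i \<bullet> x else 0)"
        by (rule sum.cong) (use orthonormalD[OF b] i in auto)
      then show ?thesis
        using i inner_commute[of x "b i"]
        by (simp add: orthogonal_def inner_diff_left R proj_mult inner_sum_left)
    qed
    then show ?thesis using orthogonal_to_span y by metis
  qed
  moreover have "dim (span (b ` {..<q})) = q" using orthonormal_dim[OF b order_refl] by simp
  ultimately show "R \<in> Gr q" unfolding Gr_def using subspace_span by blast
qed

lemma proj_mult_basis:
  assumes b: "orthonormal b m" and "q \<le> m" "i < m"
  shows "mat_of (proj b q) *v b i = (if i < q then b i else 0)"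
proof -
  have "mat_of (proj b q) *v b i = (\<Sum>j<q. if j = i then b i else 0)"
    unfolding proj_mult by (rule sum.cong) (use orthonormalD[OF b] assms in auto)
  then show ?thesis by simp
qed

lemma Gr_idem:
  assumes "R \<in> Gr q" shows "mat_of R *v (mat_of R *v x) = mat_of R *v x"
proof -
  obtain b where b: "orthonormal b q" and R: "R = proj b q" using assms Gr_iff_proj by blast
  have "mat_of R *v (mat_of R *v x) = (\<Sum>j<q. (b j \<bullet> x) *\<^sub>R (mat_of R *v b j))"
    by (subst (2) R) (simp add: proj_mult matrix_vector_mult_scaleR
        linear_sum[OF matrix_vector_mul_linear])
  also have "\<dots> = mat_of R *v x"
    by (simp add: R proj_mult_basis[OF b order_refl]) (simp add: proj_mult)
  finally show ?thesis .
qed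

lemma Gr_norm_mult:
  assumes "R \<in> Gr q" shows "(norm (mat_of R *v x))\<^sup>2 = x \<bullet> (mat_of R *v x)"
  using Gr_idem[OF assms] symmat_inner_vec[of R x "mat_of R *v x"] by (simp add: power2_norm_eq_inner)

lemma Gr_quadratic_bounds:
  assumes "R \<in> Gr q" "norm x = 1"
  shows "0 \<le> x \<bullet> (mat_of R *v x)" "x \<bullet> (mat_of R *v x) \<le> 1"
proof -
  show "0 \<le> x \<bullet> (mat_of R *v x)" by (metis Gr_norm_mult assms(1) zero_le_power2)
  have "(norm (mat_of R *v x))\<^sup>2 \<le> norm (mat_of R *v x)"
    using Gr_norm_mult[OF assms(1)] norm_cauchy_schwarz[of x "mat_of R *v x"] assms(2) by simp
  moreover have "t \<le> 1" if "t\<^sup>2 \<le> t" for t :: real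
  proof (rule ccontr)
    assume "\<not> t \<le> 1"
    then have "1 * t < t * t" by (intro mult_strict_right_mono) auto
    then show False using that by (simp add: power2_eq_square)
  qed
  ultimately have "norm (mat_of R *v x) \<le> 1" by blast
  then show "x \<bullet> (mat_of R *v x) \<le> 1"
    using norm_cauchy_schwarz[of x "mat_of R *v x"] assms(2) by simp
qed

lemma Gr_inner_self:
  assumes "R \<in> Gr q" shows "R \<bullet> R = real q"
proof -
  obtain b where b: "orthonormal b q" and R: "R = proj b q" using assms Gr_iff_proj by blast
  have "R \<bullet> R = (\<Sum>j<q. b j \<bullet> (mat_of R *v b j))" by (subst (2) R) (rule inner_proj)
  also have "\<dots> = (\<Sum>j<q. 1)"
    by (rule sum.cong) (use orthonormalD[OF b] in \<open>auto simp: R proj_mult_basis[OF b order_refl]\<close>)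
  finally show ?thesis by simp
qed

text \<open>All of \<open>Gr q\<close> lies on a sphere of squared radius \<open>q\<close>, so on it
  the squared distance to a fixed point is affine. Hence quadratic growth can follow from linear
  estimates.\<close>

lemma Gr_norm_diff:
  assumes "R \<in> Gr q" "R' \<in> Gr q" shows "(norm (R - R'))\<^sup>2 = 2 * real q - 2 * (R \<bullet> R')"
  using Gr_inner_self[OF assms(1)] Gr_inner_self[OF assms(2)]
  by (simp add: power2_norm_eq_inner inner_diff_left inner_diff_right inner_commute)

lemma Gr_trace:
  fixes R :: "'n::finite symmat"
  assumes "R \<in> Gr q" and e: "orthonormal e CARD('n)"
  shows "(\<Sum>i<CARD('n). e i \<bullet> (mat_of R *v e i)) = real q"
  using symmat_inner_orthonormal[OF e, of R R] Gr_norm_mult[OF assms(1)] Gr_inner_self[OF assms(1)]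
  by (simp add: power2_norm_eq_inner)

lemma proj_in_Gr: "orthonormal b q \<Longrightarrow> proj b q \<in> Gr q"
  using Gr_iff_proj by blast

lemma inner_eigensystem:
  fixes A B :: "'n::finite symmat"
  assumes "eigensystem (mat_of A) e l"
  shows "A \<bullet> B = (\<Sum>k<CARD('n). l k * (e k \<bullet> (mat_of B *v e k)))"
  unfolding symmat_inner_orthonormal[OF eigensystemD(1)[OF assms]]
  by (rule sum.cong) (simp_all add: eigensystemD(2)[OF assms])

lemma sum_split_lessThan:
  fixes f :: "nat \<Rightarrow> real"
  assumes "q \<le> n"
  shows "sum f {..<n} = sum f {..<q} + sum f {q..<n}"
proof -
  have "{..<n} = {..<q} \<union> {q..<n}" using assms by auto
  then show ?thesis by (simp add: sum.union_disjoint ivl_disj_int)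
qed

text \<open>Quadratic growth at the maximizer with constant half the spectral gap. It yields both
  optimality and the Lipschitz dependence of the maximizer on \<open>A\<close>.\<close>

lemma Gr_quadratic_growth:
  fixes A :: "'n::finite symmat"
  assumes el: "eigensystem (mat_of A) e l" and q: "1 \<le> q" "q < CARD('n)" and R: "R \<in> Gr q"
  shows "(l (q - 1) - l q) / 2 * (norm (proj e q - R))\<^sup>2 \<le> A \<bullet> proj e q - A \<bullet> R"
proof -
  note e = eigensystemD[OF el]
  define r where "r k = e k \<bullet> (mat_of R *v e k)" for k
  have r: "0 \<le> r k" "r k \<le> 1" if "k < CARD('n)" for k
    unfolding r_def using Gr_quadratic_bounds[OF R orthonormal_norm[OF e(1) that]] by auto
  have eq: "orthonormal e q" using e(1) orthonormal_mono q(2) less_imp_le by blast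
  \<comment> \<open>The trace \<open>q\<close> balances the weights: what \<open>R\<close> puts on
    the low eigenvectors is what it lacks on the top ones. By \<open>nrm\<close> this weight, later
    called \<open>T\<close>, is half the squared distance.\<close>
  have tr: "(\<Sum>k<q. r k) + (\<Sum>k=q..<CARD('n). r k) = q"
    using Gr_trace[OF R e(1)] sum_split_lessThan[of q "CARD('n)" r] q by (simp add: r_def)
  have Pr: "proj e q \<bullet> R = (\<Sum>k<q. r k)"
    by (subst inner_commute) (simp add: inner_proj r_def)
  have nrm: "(norm (proj e q - R))\<^sup>2 = 2 * (\<Sum>k=q..<CARD('n). r k)"
    using Gr_norm_diff[OF proj_in_Gr[OF eq] R] Pr tr by simp
  have AP: "A \<bullet> proj e q = (\<Sum>k<q. l k)"
    unfolding inner_proj by (rule sum.cong) (use e q orthonormalD[OF e(1)] in auto)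
  have AR: "A \<bullet> R = (\<Sum>k<q. l k * r k) + (\<Sum>k=q..<CARD('n). l k * r k)"
    unfolding inner_eigensystem[OF el] r_def using q by (intro sum_split_lessThan) simp
  have 1: "(\<Sum>k<q. l (q - 1) * (1 - r k)) \<le> (\<Sum>k<q. l k * (1 - r k))"
    by (rule sum_mono) (use e(3) r q in \<open>auto intro!: mult_right_mono\<close>)
  have 2: "(\<Sum>k=q..<CARD('n). l k * r k) \<le> (\<Sum>k=q..<CARD('n). l q * r k)"
    by (rule sum_mono) (use e(3) r q in \<open>auto intro!: mult_right_mono\<close>)
  define T where "T = (\<Sum>k=q..<CARD('n). r k)"
  have "(\<Sum>k<q. 1 - r k) = T" using tr by (simp add: sum_subtractf T_def)
  then have 3: "(\<Sum>k<q. l (q - 1) * (1 - r k)) = l (q - 1) * T"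
    by (simp add: sum_distrib_left[symmetric])
  have 4: "(\<Sum>k=q..<CARD('n). l q * r k) = l q * T"
    by (simp add: sum_distrib_left T_def)
  have 5: "(\<Sum>k<q. l k * (1 - r k)) = (\<Sum>k<q. l k) - (\<Sum>k<q. l k * r k)"
    by (simp add: right_diff_distrib sum_subtractf)
  have "(l (q - 1) - l q) / 2 * (2 * T) = l (q - 1) * T - l q * T" by (simp add: left_diff_distrib)
  then show ?thesis
    using 1 2 3 4 5 unfolding nrm AP AR T_def[symmetric] by linarith
qed

section \<open>Tilted linear problems on the Grassmannian\<close>

text \<open>Tilting a linear objective by \<open>v\<close> replaces \<open>S\<close> by
  \<open>S + v\<close>. Agreement of \<open>f\<close> with the linear form is asked on
  \<open>Gr q\<close> only, because the PCA objective is quadratic in a general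
  \<open>R\<close>.\<close>

lemma tilt_argmin_linear:
  fixes S P :: "'n::finite symmat"
  assumes "\<forall>R\<in>Gr q. f R = - (S \<bullet> R)"
  shows "tilt_argmin (Gr q) f P \<epsilon> v =
    {R \<in> Gr q \<inter> cball P \<epsilon>. \<forall>R'\<in>Gr q \<inter> cball P \<epsilon>. (S + v) \<bullet> R' \<le> (S + v) \<bullet> R}"
proof -
  have *: "f R - v \<bullet> R < f R' - v \<bullet> R' \<longleftrightarrow> \<not> (S + v) \<bullet> R \<le> (S + v) \<bullet> R'"
    if "R \<in> Gr q" "R' \<in> Gr q" for R R'
    using assms that by (auto simp: inner_add_left)
  show ?thesis unfolding tilt_argmin_def is_arg_min_def using * by blast
qed

lemma proj_is_arg_min:
  fixes S :: "'n::finite symmat"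
  assumes f: "\<forall>R\<in>Gr q. f R = - (S \<bullet> R)"
    and el: "eigensystem (mat_of S) e l" and q: "1 \<le> q" "q < CARD('n)"
  shows "is_arg_min f (\<lambda>R. R \<in> Gr q) (proj e q)"
proof -
  have P: "proj e q \<in> Gr q"
    using eigensystemD(1)[OF el] q by (intro proj_in_Gr) (simp add: orthonormal_def)
  have "0 \<le> (l (q - 1) - l q) / 2" using eigensystemD(3)[OF el, of "q - 1" q] q by simp
  then have "0 \<le> (l (q - 1) - l q) / 2 * (norm (proj e q - R))\<^sup>2" for R
    by (intro mult_nonneg_nonneg) simp_all
  then have "f (proj e q) \<le> f R" if "R \<in> Gr q" for R
    using Gr_quadratic_growth[OF el q that] f that P by (smt (verit))
  then show ?thesis using P unfolding is_arg_min_def by (meson not_le)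
qed

text \<open>Already the untilted problem has a second solution in every ball, so
  \<open>tilt_argmin\<close> at 0 is not a singleton for any radius.\<close>

lemma no_gap_not_tilt_stable:
  fixes S :: "'n::finite symmat"
  assumes f: "\<forall>R\<in>Gr q. f R = - (S \<bullet> R)"
    and el: "eigensystem (mat_of S) e l" and q: "1 \<le> q" "q < CARD('n)" and gap: "l (q - 1) = l q"
  shows "\<not> tilt_stable (Gr q) f (proj e q)"
proof
  note e = eigensystemD[OF el]
  note D = orthonormalD[OF e(1)]
  assume "tilt_stable (Gr q) f (proj e q)"
  then obtain \<epsilon> where eps: "\<epsilon> > 0" and am: "tilt_argmin (Gr q) f (proj e q) \<epsilon> 0 = {proj e q}"
    unfolding tilt_stable_def tilt_map_def by metis
  \<comment> \<open>\<open>s\<close> is the sine of the rotation angle. The moved projection is at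
    distance \<open>sqrt 2 * s\<close>, below \<open>2 * s \<le> \<epsilon>\<close>; the bound 1/2
    keeps \<open>1 - s\<^sup>2\<close> nonnegative.\<close>
  define s where "s = min (\<epsilon> / 2) (1 / 2)"
  define c where "c = sqrt (1 - s\<^sup>2)"
  have s: "0 < s" "s \<le> \<epsilon> / 2" "s \<le> 1 / 2" using eps by (auto simp: s_def)
  have "s\<^sup>2 \<le> 1" using s by (intro power_le_one) auto
  then have cs: "c\<^sup>2 = 1 - s\<^sup>2" by (simp add: c_def)
  define w where "w = c *\<^sub>R e (q - 1) + s *\<^sub>R e q"
  define b where "b j = (if j = q - 1 then w else e j)" for j
  have ww: "w \<bullet> w = 1"
    using D[of "q-1" "q-1"] D[of q q] D[of "q-1" q] D[of q "q-1"] q cs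
    by (simp add: w_def inner_add_left inner_add_right power2_eq_square)
  have ew: "e j \<bullet> w = 0" if "j < q - 1" for j
    using D[of j q] D[of j "q-1"] q that by (simp add: w_def inner_add_right)
  have b: "orthonormal b q"
    unfolding orthonormal_def b_def
    using ww ew D q by (auto simp: inner_commute)
  have Rin: "proj b q \<in> Gr q" by (rule proj_in_Gr[OF b])
  have Pin: "proj e q \<in> Gr q" using e(1) q by (intro proj_in_Gr) (simp add: orthonormal_def)
  obtain p where p: "q = Suc p" using q by (cases q) auto
  have bj: "b j = e j" if "j < p" for j using that p by (simp add: b_def)
  have bp: "b p = w" using p by (simp add: b_def)
  have Sw: "w \<bullet> (mat_of S *v w) = l q"
  proof -
    have "mat_of S *v w = l q *\<^sub>R w"
      using e(2)[of q] e(2)[of "q-1"] q gap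
      by (simp add: w_def matrix_vector_right_distrib matrix_vector_mult_scaleR scaleR_add_right mult.commute[of _ "l q"])
    then show ?thesis using ww by simp
  qed
  have same: "S \<bullet> proj b q = S \<bullet> proj e q"
    unfolding inner_proj using bj bp Sw e(2)[of p] D[of p p] q gap p by (simp add: p)
  have "mat_of (proj e q) *v w = c *\<^sub>R e p"
    using proj_mult_basis[OF e(1), of q "q-1"] proj_mult_basis[OF e(1), of q q] q p
    by (simp add: w_def matrix_vector_right_distrib matrix_vector_mult_scaleR)
  then have "w \<bullet> (mat_of (proj e q) *v w) = c\<^sup>2"
    using D[of p p] D[of "Suc p" p] p q by (simp add: w_def inner_add_left power2_eq_square)
  moreover have "e j \<bullet> (mat_of (proj e q) *v e j) = 1" if "j < p" for j
    using proj_mult_basis[OF e(1), of q j] D[of j j] q p that by simp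
  ultimately have "proj e q \<bullet> proj b q = p + c\<^sup>2"
    unfolding inner_proj[of "proj e q" b] using bj bp by (simp add: p)
  then have nrm: "(norm (proj e q - proj b q))\<^sup>2 = 2 * s\<^sup>2"
    using Gr_norm_diff[OF Pin Rin] cs p by simp
  then have "proj b q \<noteq> proj e q" using s by (metis diff_self mult_eq_0_iff norm_zero power_zero_numeral
      less_irrefl power_eq_0_iff zero_neq_numeral)
  have "(norm (proj e q - proj b q))\<^sup>2 \<le> (2 * s)\<^sup>2" by (simp add: nrm)
  then have "norm (proj e q - proj b q) \<le> 2 * s" by (rule power2_le_imp_le) (use s in simp)
  then have "proj b q \<in> cball (proj e q) \<epsilon>" using s by (simp add: dist_norm)
  moreover have "\<forall>R'\<in>Gr q \<inter> cball (proj e q) \<epsilon>. (S + 0) \<bullet> R' \<le> (S + 0) \<bullet> proj e q"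
  proof -
    have P: "proj e q \<in> tilt_argmin (Gr q) f (proj e q) \<epsilon> 0" by (simp only: am singletonI)
    show ?thesis
      using P[unfolded tilt_argmin_linear[OF f, where v = 0] mem_Collect_eq] by (rule conjunct2)
  qed
  ultimately have "proj b q \<in> tilt_argmin (Gr q) f (proj e q) \<epsilon> 0"
    using Rin by (simp only: tilt_argmin_linear[OF f, where v = 0] mem_Collect_eq Int_iff same add_0_right simp_thms)
  then show False using am \<open>proj b q \<noteq> proj e q\<close> by simp
qed

section \<open>Perturbation of spectral projections\<close>

text \<open>Grassmann's dimension formula leaves the intersection a positive dimension. With two
  eigenbases this yields a direction controlled by both matrices.\<close>

lemma orthonormal_spans_meet:
  fixes e e' :: "nat \<Rightarrow> real ^ 'n::finite"
  assumes "orthonormal e CARD('n)" "orthonormal e' CARD('n)" "I \<subseteq> {..<CARD('n)}" "J \<subseteq> {..<CARD('n)}"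
    and c: "CARD('n) < card I + card J"
  obtains z where "norm z = 1" "z \<in> span (e ` I)" "z \<in> span (e' ` J)"
proof -
  let ?U = "span (e ` I)" and ?V = "span (e' ` J)"
  have "dim {x + y |x y. x \<in> ?U \<and> y \<in> ?V} + dim (?U \<inter> ?V) = card I + card J"
    using orthonormal_dim[OF assms(1,3)] orthonormal_dim[OF assms(2,4)] by (simp add: dim_sums_Int)
  moreover have "dim {x + y |x y. x \<in> ?U \<and> y \<in> ?V} \<le> CARD('n)"
    using dim_subset_UNIV[of "{x + y |x y. x \<in> ?U \<and> y \<in> ?V}"] by simp
  ultimately have "dim (?U \<inter> ?V) \<noteq> 0" using c by linarith
  then obtain x where x: "x \<in> ?U \<inter> ?V" "x \<noteq> 0"
    by (metis dim_eq_0 singletonI subsetI)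
  show ?thesis
    by (rule that[of "x /\<^sub>R norm x"]) (use x in \<open>auto intro: span_scale\<close>)
qed

lemma orthonormal_span_zero:
  assumes e: "orthonormal e m" and I: "I \<subseteq> {..<m}" and z: "z \<in> span (e ` I)" and "i < m" "i \<notin> I"
  shows "e i \<bullet> z = 0"
proof -
  have "orthogonal (e i) y" if "y \<in> e ` I" for y
    using that orthonormalD[OF e \<open>i < m\<close>] I \<open>i \<notin> I\<close> by (auto simp: orthogonal_def subset_iff)
  then have "orthogonal (e i) z" using z orthogonal_to_span by metis
  then show ?thesis by (simp add: orthogonal_def)
qed

lemma quadratic_form_eigensystem:
  fixes A :: "real ^ 'n ^ 'n::finite"
  assumes A: "transpose A = A" and el: "eigensystem A e l"
  shows "z \<bullet> (A *v z) = (\<Sum>i<CARD('n). l i * (e i \<bullet> z)\<^sup>2)"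
proof -
  note e = eigensystemD[OF el]
  have "e i \<bullet> (A *v z) = l i * (e i \<bullet> z)" if "i < CARD('n)" for i
    using sym_matrix_inner[OF A, of "e i" z] e(2)[OF that] by simp
  then show ?thesis
    unfolding parseval[OF e(1), of z "A *v z"] by (intro sum.cong) (auto simp: power2_eq_square)
qed

lemma quadratic_form_ge:
  fixes A :: "real ^ 'n ^ 'n::finite"
  assumes A: "transpose A = A" and el: "eigensystem A e l"
    and I: "I \<subseteq> {..<CARD('n)}" and z: "z \<in> span (e ` I)" "norm z = 1"
    and c: "\<And>i. i \<in> I \<Longrightarrow> c \<le> l i"
  shows "c \<le> z \<bullet> (A *v z)"
proof -
  note e = eigensystemD[OF el]
  have "c = (\<Sum>i<CARD('n). c * (e i \<bullet> z)\<^sup>2)"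
    using parseval[OF e(1), of z z] z(2)
    by (simp add: sum_distrib_left[symmetric] power2_eq_square norm_eq_1)
  also have "\<dots> \<le> (\<Sum>i<CARD('n). l i * (e i \<bullet> z)\<^sup>2)"
  proof (rule sum_mono)
    fix i assume "i \<in> {..<CARD('n)}"
    then show "c * (e i \<bullet> z)\<^sup>2 \<le> l i * (e i \<bullet> z)\<^sup>2"
      using orthonormal_span_zero[OF e(1) I z(1), of i] c[of i]
      by (cases "i \<in> I") (auto intro: mult_right_mono)
  qed
  finally show ?thesis by (simp add: quadratic_form_eigensystem[OF A el])
qed

lemma quadratic_form_le:
  fixes A :: "real ^ 'n ^ 'n::finite"
  assumes A: "transpose A = A" and el: "eigensystem A e l"
    and I: "I \<subseteq> {..<CARD('n)}" and z: "z \<in> span (e ` I)" "norm z = 1"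
    and c: "\<And>i. i \<in> I \<Longrightarrow> l i \<le> c"
  shows "z \<bullet> (A *v z) \<le> c"
proof -
  note e = eigensystemD[OF el]
  have "(\<Sum>i<CARD('n). l i * (e i \<bullet> z)\<^sup>2) \<le> (\<Sum>i<CARD('n). c * (e i \<bullet> z)\<^sup>2)"
  proof (rule sum_mono)
    fix i assume "i \<in> {..<CARD('n)}"
    then show "l i * (e i \<bullet> z)\<^sup>2 \<le> c * (e i \<bullet> z)\<^sup>2"
      using orthonormal_span_zero[OF e(1) I z(1), of i] c[of i]
      by (cases "i \<in> I") (auto intro: mult_right_mono)
  qed
  also have "\<dots> = c"
    using parseval[OF e(1), of z z] z(2)
    by (simp add: sum_distrib_left[symmetric] power2_eq_square norm_eq_1)
  finally show ?thesis by (simp add: quadratic_form_eigensystem[OF A el])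
qed

text \<open>Weyl's inequality by the Courant-Fischer argument: the top \<open>k + 1\<close>
  eigenvectors of \<open>A\<close> and the bottom \<open>CARD('n) - k\<close> of \<open>A'\<close>
  span spaces sharing a unit vector, at which the two quadratic forms differ by at most
  \<open>norm (A' - A)\<close>.\<close>

lemma eigenvalue_perturbation_ge:
  fixes A A' :: "'n::finite symmat"
  assumes el: "eigensystem (mat_of A) e l" and el': "eigensystem (mat_of A') e' l'" and k: "k < CARD('n)"
  shows "l k - norm (A' - A) \<le> l' k"
proof -
  obtain z where z: "norm z = 1" "z \<in> span (e ` {..k})" "z \<in> span (e' ` {k..<CARD('n)})"
    by (rule orthonormal_spans_meet[OF eigensystemD(1)[OF el] eigensystemD(1)[OF el'],
          of "{..k}" "{k..<CARD('n)}"]) (use k in auto)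
  have "l k \<le> z \<bullet> (mat_of A *v z)"
    by (rule quadratic_form_ge[OF _ el _ z(2,1)]) (use k eigensystemD(3)[OF el] in auto)
  moreover have "z \<bullet> (mat_of A' *v z) \<le> l' k"
    by (rule quadratic_form_le[OF _ el' _ z(3,1)]) (use k eigensystemD(3)[OF el'] in auto)
  moreover have "\<bar>z \<bullet> (mat_of (A' - A) *v z)\<bar> \<le> norm (A' - A)"
    using Cauchy_Schwarz_ineq2[of z "mat_of (A' - A) *v z"] symmat_norm_mult_le[of "A' - A" z] z(1)
    by simp
  ultimately show ?thesis
    by (simp add: matrix_vector_mult_diff_rdistrib inner_diff_right)
qed

text \<open>The two eigenvalues may approach each other from both sides, hence the factor 2.\<close>

lemma eigenvalue_gap_perturbation:
  fixes A A' :: "'n::finite symmat"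
  assumes "eigensystem (mat_of A) e l" "eigensystem (mat_of A') e' l'" "1 \<le> q" "q < CARD('n)"
  shows "l (q - 1) - l q - 2 * norm (A' - A) \<le> l' (q - 1) - l' q"
  using eigenvalue_perturbation_ge[OF assms(1,2), of "q - 1"]
    eigenvalue_perturbation_ge[OF assms(2,1), of q] assms(3,4) norm_minus_commute[of A A']
  by (simp add: less_imp_diff_less)

text \<open>Each projection competes in the problem of the other matrix. Adding the two growth
  inequalities bounds \<open>\<delta>\<close> times the squared distance by the inner product of the
  two increments; Cauchy-Schwarz then cancels one factor.\<close>

lemma spectral_projection_lipschitz:
  fixes A A' :: "'n::finite symmat"
  assumes el: "eigensystem (mat_of A) e l" and el': "eigensystem (mat_of A') e' l'"
    and q: "1 \<le> q" "q < CARD('n)"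
    and gap: "\<delta> > 0" "\<delta> \<le> l (q - 1) - l q" "\<delta> \<le> l' (q - 1) - l' q"
  shows "norm (proj e' q - proj e q) \<le> norm (A' - A) / \<delta>"
proof -
  define N where "N = norm (proj e' q - proj e q)"
  have P: "proj e q \<in> Gr q" "proj e' q \<in> Gr q"
    using eigensystemD(1)[OF el] eigensystemD(1)[OF el'] q
    by (auto intro!: proj_in_Gr simp: orthonormal_def)
  have N: "norm (proj e q - proj e' q) = N" by (simp add: N_def norm_minus_commute)
  have "\<delta> / 2 * N\<^sup>2 \<le> (l (q - 1) - l q) / 2 * N\<^sup>2" "\<delta> / 2 * N\<^sup>2 \<le> (l' (q - 1) - l' q) / 2 * N\<^sup>2"
    using gap by (auto intro!: mult_right_mono)
  then have "\<delta> * N\<^sup>2 \<le> (A' - A) \<bullet> (proj e' q - proj e q)"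
    using Gr_quadratic_growth[OF el q P(2)] Gr_quadratic_growth[OF el' q P(1)]
    unfolding N N_def[symmetric] by (simp add: inner_diff_left inner_diff_right)
  also have "\<dots> \<le> norm (A' - A) * N" unfolding N_def by (rule norm_cauchy_schwarz)
  finally have "\<delta> * N * N \<le> norm (A' - A) * N" by (simp add: power2_eq_square mult.assoc)
  then have "\<delta> * N \<le> norm (A' - A)"
  proof (cases "N = 0")
    case False
    then show ?thesis using \<open>\<delta> * N * N \<le> _\<close> mult_le_cancel_right[of "\<delta> * N" N "norm (A' - A)"]
      by (simp add: N_def)
  qed simp
  then show ?thesis using gap(1) by (simp add: N_def field_simps)
qed

section \<open>First-order term of a spectral projection\<close>

lemma symmat_entries_eqI:
  fixes A B :: "'n::finite symmat"
  assumes e: "orthonormal e CARD('n)"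
    and "\<And>i k. i < CARD('n) \<Longrightarrow> k < CARD('n) \<Longrightarrow> e i \<bullet> (mat_of A *v e k) = e i \<bullet> (mat_of B *v e k)"
  shows "A = B"
proof -
  have "(norm (A - B))\<^sup>2 = 0"
    unfolding symmat_norm_orthonormal[OF e] using assms(2)
    by (intro sum.neutral ballI) (auto simp: matrix_vector_mult_diff_rdistrib inner_diff_right)
  then show ?thesis by simp
qed

text \<open>The matrix with entries \<open>X\<close> in the basis \<open>e\<close>. Users supply a
  symmetric \<open>X\<close>, since \<open>symm\<close> is meaningful only on symmetric
  arguments.\<close>

definition frame :: "(nat \<Rightarrow> real ^ 'n) \<Rightarrow> (nat \<Rightarrow> nat \<Rightarrow> real) \<Rightarrow> 'n::finite symmat" where
  "frame e X = symm (\<chi> r s. \<Sum>i<CARD('n). \<Sum>j<CARD('n). X i j * (e i $ r * e j $ s))"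

lemma frame_entry:
  fixes e :: "nat \<Rightarrow> real ^ 'n::finite"
  assumes e: "orthonormal e CARD('n)" and sym: "\<And>i j. X i j = X j i"
    and ab: "a < CARD('n)" "b < CARD('n)"
  shows "e a \<bullet> (mat_of (frame e X) *v e b) = X a b"
proof -
  let ?M = "(\<chi> r s. \<Sum>i<CARD('n). \<Sum>j<CARD('n). X i j * (e i $ r * e j $ s)) :: real ^ 'n ^ 'n"
  have "transpose ?M = ?M"
    unfolding transpose_def vec_eq_iff
    by (auto simp: mult.commute sym intro: sum.swap[THEN trans])
  then have M: "mat_of (frame e X) = ?M" unfolding frame_def by (intro symm_inverse) simp
  have "?M *v x = (\<Sum>i<CARD('n). \<Sum>j<CARD('n). (X i j * (e j \<bullet> x)) *\<^sub>R e i)" for x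
  proof (subst vec_eq_iff, intro allI)
    fix r
    have "(?M *v x) $ r = (\<Sum>s\<in>UNIV. \<Sum>i<CARD('n). \<Sum>j<CARD('n). X i j * (e i $ r * e j $ s) * x $ s)"
      by (simp add: matrix_vector_mult_def sum_distrib_right)
    also have "\<dots> = (\<Sum>i<CARD('n). \<Sum>s\<in>UNIV. \<Sum>j<CARD('n). X i j * (e i $ r * e j $ s) * x $ s)"
      by (rule sum.swap)
    also have "\<dots> = (\<Sum>i<CARD('n). \<Sum>j<CARD('n). \<Sum>s\<in>UNIV. X i j * (e i $ r * e j $ s) * x $ s)"
      by (intro sum.cong refl sum.swap)
    also have "\<dots> = (\<Sum>i<CARD('n). \<Sum>j<CARD('n). (X i j * (e j \<bullet> x)) *\<^sub>R e i) $ r"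
      by (simp add: inner_vec_def sum_distrib_left sum_distrib_right mult_ac)
    finally show "(?M *v x) $ r = \<dots>" .
  qed
  then have "e a \<bullet> (?M *v e b) = (\<Sum>i<CARD('n). \<Sum>j<CARD('n). (X i j * (e j \<bullet> e b)) * (e a \<bullet> e i))"
    by (simp add: inner_sum_right)
  also have "\<dots> = (\<Sum>i<CARD('n). \<Sum>j<CARD('n). if j = b then (if i = a then X a b else 0) else 0)"
    by (intro sum.cong refl) (use orthonormalD[OF e] ab in auto)
  also have "\<dots> = X a b" using ab by simp
  finally show ?thesis by (simp add: M)
qed

text \<open>Divided differences \<open>(p i - p j) / (l i - l j)\<close> of the indicator
  \<open>p\<close> of the first \<open>q\<close> indices. Inside a block, where the denominator may
  vanish, the value is 0.\<close>

definition gap_coeff :: "(nat \<Rightarrow> real) \<Rightarrow> nat \<Rightarrow> nat \<Rightarrow> nat \<Rightarrow> real" where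
  "gap_coeff l q i j = (if i < q \<and> q \<le> j then 1 / (l i - l j)
     else if j < q \<and> q \<le> i then 1 / (l j - l i) else 0)"

text \<open>The Daleckii-Krein formula: in the eigenbasis the derivative multiplies the entries of
  \<open>H\<close> by divided differences, so only the off-diagonal blocks respond.\<close>

definition dproj :: "(nat \<Rightarrow> real ^ 'n) \<Rightarrow> (nat \<Rightarrow> real) \<Rightarrow> nat \<Rightarrow> 'n::finite symmat \<Rightarrow> 'n symmat" where
  "dproj e l q H = frame e (\<lambda>i j. gap_coeff l q i j * (e i \<bullet> (mat_of H *v e j)))"

lemma dproj_entry:
  fixes e :: "nat \<Rightarrow> real ^ 'n::finite"
  assumes e: "orthonormal e CARD('n)" and "a < CARD('n)" "b < CARD('n)"
  shows "e a \<bullet> (mat_of (dproj e l q H) *v e b) = gap_coeff l q a b * (e a \<bullet> (mat_of H *v e b))"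
proof -
  have "gap_coeff l q i j * (e i \<bullet> (mat_of H *v e j)) = gap_coeff l q j i * (e j \<bullet> (mat_of H *v e i))"
    for i j
    using symmat_inner_vec[of H "e i" "e j"]
    by (auto simp: gap_coeff_def inner_commute)
  then show ?thesis unfolding dproj_def by (rule frame_entry[OF e _ assms(2,3)])
qed

lemma linear_dproj:
  fixes e :: "nat \<Rightarrow> real ^ 'n::finite"
  assumes e: "orthonormal e CARD('n)"
  shows "linear (dproj e l q)"
proof (rule linearI)
  show "dproj e l q (H + K) = dproj e l q H + dproj e l q K" for H K
    by (rule symmat_entries_eqI[OF e])
      (simp add: dproj_entry[OF e] matrix_vector_mult_add_rdistrib inner_add_right algebra_simps)
  show "dproj e l q (c *\<^sub>R H) = c *\<^sub>R dproj e l q H" for c H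
    by (rule symmat_entries_eqI[OF e])
      (simp add: dproj_entry[OF e] scaleR_matrix_vector_assoc[symmetric])
qed

lemma gap_coeff_bound:
  fixes e :: "nat \<Rightarrow> real ^ 'n::finite"
  assumes el: "eigensystem A e l" and q: "1 \<le> q" "q < CARD('n)" and gap: "l q < l (q - 1)"
    and ij: "i < CARD('n)" "j < CARD('n)"
  shows "\<bar>gap_coeff l q i j\<bar> \<le> 1 / (l (q - 1) - l q)"
proof -
  have "l (q - 1) - l q \<le> l i - l j" if "i < q" "q \<le> j" "j < CARD('n)" for i j
  proof -
    have "i \<le> q - 1" "q - 1 < CARD('n)" using that q by auto
    then show ?thesis
      using eigensystemD(3)[OF el, of i "q - 1"] eigensystemD(3)[OF el, of q j] that by simp
  qed
  note * = this[of i j] this[of j i]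
  show ?thesis
    using * gap ij unfolding gap_coeff_def by (auto intro!: divide_left_mono mult_pos_pos)
qed

text \<open>The squared norm is the sum of squared entries in the eigenbasis, so an entrywise
  multiplier has norm at most its largest coefficient, which belongs to the pair
  \<open>q - 1\<close>, \<open>q\<close>.\<close>

lemma onorm_dproj:
  fixes A :: "real ^ 'n ^ 'n::finite"
  assumes el: "eigensystem A e l" and q: "1 \<le> q" "q < CARD('n)" and gap: "l q < l (q - 1)"
  shows "onorm (dproj e l q) = 1 / (l (q - 1) - l q)"
proof (rule antisym)
  note e = eigensystemD(1)[OF el]
  let ?g = "1 / (l (q - 1) - l q)"
  have g: "0 \<le> ?g" using gap by simp
  show "onorm (dproj e l q) \<le> ?g"
  proof (rule onorm_bound[OF g])
    fix H
    have "(norm (dproj e l q H))\<^sup>2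
        = (\<Sum>k<CARD('n). \<Sum>i<CARD('n). (gap_coeff l q i k)\<^sup>2 * (e i \<bullet> (mat_of H *v e k))\<^sup>2)"
      unfolding symmat_norm_orthonormal[OF e] by (simp add: dproj_entry[OF e] power_mult_distrib)
    also have "\<dots> \<le> (\<Sum>k<CARD('n). \<Sum>i<CARD('n). ?g\<^sup>2 * (e i \<bullet> (mat_of H *v e k))\<^sup>2)"
    proof (intro sum_mono mult_right_mono)
      fix k i assume "k \<in> {..<CARD('n)}" "i \<in> {..<CARD('n)}"
      then have "\<bar>gap_coeff l q i k\<bar> \<le> \<bar>?g\<bar>" using gap_coeff_bound[OF el q gap, of i k] g by auto
      then show "(gap_coeff l q i k)\<^sup>2 \<le> ?g\<^sup>2" by (simp only: abs_le_square_iff)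
    qed simp
    also have "\<dots> = (?g * norm H)\<^sup>2"
      unfolding power_mult_distrib symmat_norm_orthonormal[OF e] by (simp only: sum_distrib_left)
    finally show "norm (dproj e l q H) \<le> ?g * norm H"
      by (rule power2_le_imp_le) (use g in simp)
  qed
  \<comment> \<open>\<open>H\<close> swaps \<open>e (q - 1)\<close> and \<open>e q\<close> and kills
    the rest: only entries with the extreme coefficient survive, so the bound is attained.\<close>
  define X :: "nat \<Rightarrow> nat \<Rightarrow> real" where
    "X i j = (if (i = q - 1 \<and> j = q) \<or> (i = q \<and> j = q - 1) then 1 else 0)" for i j
  define H where "H = frame e X"
  have H: "e i \<bullet> (mat_of H *v e k) = X i k" if "i < CARD('n)" "k < CARD('n)" for i k
    unfolding H_def by (rule frame_entry[OF e _ that]) (auto simp: X_def)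
  have "dproj e l q H = ?g *\<^sub>R H"
    by (rule symmat_entries_eqI[OF e])
      (use q in \<open>auto simp: dproj_entry[OF e] H X_def gap_coeff_def scaleR_matrix_vector_assoc[symmetric]\<close>)
  then have "?g * norm H = norm (dproj e l q H)" using g by simp
  also have "\<dots> \<le> onorm (dproj e l q) * norm H"
    using linear_dproj[OF e] by (intro onorm) (simp add: linear_conv_bounded_linear)
  finally have "?g * norm H \<le> onorm (dproj e l q) * norm H" .
  moreover have "H \<noteq> 0" using H[of "q - 1" q] q by (auto simp: X_def less_imp_diff_less)
  ultimately show "?g \<le> onorm (dproj e l q)"
    by (meson mult_le_cancel_right_pos zero_less_norm_iff)
qed

text \<open>Entrywise in the eigenbasis of \<open>A\<close>: the off-diagonal blocks of the increment are controlled by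
  the commutation of each projection with its matrix, the diagonal blocks by idempotence.\<close>

lemma spectral_projection_remainder:
  fixes A A' :: "'n::finite symmat"
  assumes el: "eigensystem (mat_of A) e l" and el': "eigensystem (mat_of A') e' l'"
    and q: "1 \<le> q" "q < CARD('n)"
    and gap: "\<delta> > 0" "\<delta> \<le> l (q - 1) - l q" "\<delta> \<le> l' (q - 1) - l' q"
  shows "norm (proj e' q - proj e q - dproj e l q (A' - A))
    \<le> 2 * CARD('n) / \<delta>\<^sup>2 * (norm (A' - A))\<^sup>2"
proof -
  note e = eigensystemD[OF el] and e' = eigensystemD[OF el']
  define P where "P = proj e q"
  define P' where "P' = proj e' q"
  define H where "H = A' - A"
  define \<Delta> where "\<Delta> = P' - P"
  define p :: "nat \<Rightarrow> real" where "p i = (if i < q then 1 else 0)" for i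
  have Pin: "P' \<in> Gr q" unfolding P'_def using e'(1) q by (intro proj_in_Gr) (simp add: orthonormal_def)
  have lip: "norm \<Delta> \<le> norm H / \<delta>"
    unfolding \<Delta>_def H_def P_def P'_def by (rule spectral_projection_lipschitz[OF el el' q gap])
  have vec: "norm (mat_of M *v e i) \<le> norm M" if "i < CARD('n)" for M i
    using symmat_norm_mult_le[of M "e i"] orthonormal_norm[OF e(1) that] by simp
  have P'e: "mat_of P' *v e i = p i *\<^sub>R e i + mat_of \<Delta> *v e i" if "i < CARD('n)" for i
    using proj_mult_basis[OF e(1), of q i] q that
    by (auto simp: \<Delta>_def P_def p_def matrix_vector_mult_diff_rdistrib)
  have A'e: "mat_of A' *v e i = l i *\<^sub>R e i + mat_of H *v e i" if "i < CARD('n)" for i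
    using e(2)[OF that] by (simp add: H_def matrix_vector_mult_diff_rdistrib)
  \<comment> \<open>\<open>P'\<close> is a spectral projection of \<open>A'\<close>, so both
    products agree on the eigenbasis \<open>e'\<close>.\<close>
  have comm: "mat_of P' *v (mat_of A' *v x) = mat_of A' *v (mat_of P' *v x)" for x
  proof -
    have lin: "linear (\<lambda>x. mat_of P' *v (mat_of A' *v x))" "linear (\<lambda>x. mat_of A' *v (mat_of P' *v x))"
      using linear_compose[OF matrix_vector_mul_linear matrix_vector_mul_linear] by (auto simp: o_def)
    have "mat_of P' *v (mat_of A' *v y) = mat_of A' *v (mat_of P' *v y)" if "y \<in> e' ` {..<CARD('n)}" for y
      using that e'(2) proj_mult_basis[OF e'(1), of q] q
      by (auto simp: P'_def matrix_vector_mult_scaleR)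
    then show ?thesis
      using linear_eq_on_span[OF lin, of "e' ` {..<CARD('n)}" x] orthonormal_span_UNIV[OF e'(1)] by auto
  qed
  have entry: "\<bar>e i \<bullet> (mat_of (\<Delta> - dproj e l q H) *v e j)\<bar> \<le> 2 / \<delta>\<^sup>2 * (norm H)\<^sup>2"
    if ij: "i < CARD('n)" "j < CARD('n)" for i j
  proof -
    have D: "e i \<bullet> e j = (if i = j then 1 else 0)" by (rule orthonormalD[OF e(1) ij])
    define d where "d = e i \<bullet> (mat_of \<Delta> *v e j)"
    define h where "h = e i \<bullet> (mat_of H *v e j)"
    have d': "(mat_of \<Delta> *v e i) \<bullet> e j = d" unfolding d_def by (rule symmat_inner_vec)
    have h': "(mat_of H *v e i) \<bullet> e j = h" unfolding h_def by (rule symmat_inner_vec)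
    have goal: "e i \<bullet> (mat_of (\<Delta> - dproj e l q H) *v e j) = d - gap_coeff l q i j * h"
      by (simp add: matrix_vector_mult_diff_rdistrib inner_diff_right dproj_entry[OF e(1) ij] d_def h_def)
    show ?thesis
    proof (cases "i < q \<longleftrightarrow> j < q")
      case True
      \<comment> \<open>Within a block, idempotence reads \<open>2 * p * d + s = d\<close>, with
        \<open>p\<close> equal to 0 or 1 and \<open>s\<close> the inner product of the images of
        \<open>e i\<close> and \<open>e j\<close> under \<open>\<Delta>\<close>. Hence
        \<open>d\<close> is \<open>s\<close> or \<open>- s\<close>, of second order.\<close>
      have "(mat_of P' *v e i) \<bullet> (mat_of P' *v e j) = e i \<bullet> (mat_of P' *v e j)"
        using Gr_idem[OF Pin, of "e j"] by (simp add: symmat_inner_vec)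
      then have "p i * p j * (e i \<bullet> e j) + p i * d + p j * d + (mat_of \<Delta> *v e i) \<bullet> (mat_of \<Delta> *v e j)
          = p j * (e i \<bullet> e j) + d"
        unfolding P'e[OF ij(1)] P'e[OF ij(2)]
        by (simp add: inner_add_left inner_add_right d' d_def[symmetric] algebra_simps)
      moreover have "p i = p j" "p i = 0 \<or> p i = 1" using True by (auto simp: p_def)
      ultimately have "\<bar>d\<bar> = \<bar>(mat_of \<Delta> *v e i) \<bullet> (mat_of \<Delta> *v e j)\<bar>" by auto
      also have "\<dots> \<le> norm (mat_of \<Delta> *v e i) * norm (mat_of \<Delta> *v e j)" by (rule Cauchy_Schwarz_ineq2)
      also have "\<dots> \<le> (norm H / \<delta>) * (norm H / \<delta>)"
        using vec[OF ij(1), of \<Delta>] vec[OF ij(2), of \<Delta>] lip gap by (intro mult_mono) auto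
      also have "\<dots> \<le> 2 / \<delta>\<^sup>2 * (norm H)\<^sup>2"
        by (simp add: power2_eq_square divide_right_mono)
      finally have "\<bar>d\<bar> \<le> 2 / \<delta>\<^sup>2 * (norm H)\<^sup>2" .
      moreover have "gap_coeff l q i j = 0" using True by (auto simp: gap_coeff_def)
      ultimately show ?thesis unfolding goal by simp
    next
      case False
      then have ne: "i \<noteq> j" by auto
      define u where "u = (mat_of H *v e i) \<bullet> (mat_of \<Delta> *v e j) - (mat_of \<Delta> *v e i) \<bullet> (mat_of H *v e j)"
      \<comment> \<open>Across blocks, commutation makes the product of \<open>P'\<close> and
        \<open>A'\<close> symmetric. Its entry is a linear equation for \<open>d\<close> with
        leading solution \<open>gap_coeff l q i j * h\<close>; the rest, \<open>u\<close>, pairs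
        \<open>H\<close> with \<open>\<Delta>\<close>.\<close>
      have "(mat_of P' *v e i) \<bullet> (mat_of A' *v e j) = (mat_of A' *v e i) \<bullet> (mat_of P' *v e j)"
        by (simp add: symmat_inner_vec comm)
      then have eq: "(l j - l i) * d = (p j - p i) * h + u"
        unfolding P'e[OF ij(1)] P'e[OF ij(2)] A'e[OF ij(1)] A'e[OF ij(2)] u_def
        by (simp add: inner_add_left inner_add_right d' h' d_def[symmetric] h_def[symmetric] D ne algebra_simps)
      have "\<bar>u\<bar> \<le> norm (mat_of H *v e i) * norm (mat_of \<Delta> *v e j) + norm (mat_of \<Delta> *v e i) * norm (mat_of H *v e j)"
        unfolding u_def using Cauchy_Schwarz_ineq2[of "mat_of H *v e i" "mat_of \<Delta> *v e j"]
          Cauchy_Schwarz_ineq2[of "mat_of \<Delta> *v e i" "mat_of H *v e j"] by linarith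
      also have "\<dots> \<le> norm H * (norm H / \<delta>) + (norm H / \<delta>) * norm H"
        using vec[OF ij(1)] vec[OF ij(2)] lip gap
        by (intro add_mono mult_mono) (auto intro: order_trans)
      finally have u: "\<bar>u\<bar> \<le> 2 * (norm H)\<^sup>2 / \<delta>" by (simp add: power2_eq_square)
      have far: "\<delta> \<le> l i - l j" if "i < q" "q \<le> j" "j < CARD('n)" for i j
      proof -
        have "i \<le> q - 1" "q - 1 < CARD('n)" using that q by auto
        then show ?thesis using e(3)[of i "q - 1"] e(3)[of q j] that gap(2) by simp
      qed
      have gam: "\<bar>gap_coeff l q i j\<bar> \<le> 1 / \<delta>" "\<bar>d - gap_coeff l q i j * h\<bar> = \<bar>gap_coeff l q i j * u\<bar>"
      proof -
        consider "i < q" "q \<le> j" | "j < q" "q \<le> i" using False by linarith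
        then have "\<bar>gap_coeff l q i j\<bar> \<le> 1 / \<delta> \<and> \<bar>d - gap_coeff l q i j * h\<bar> = \<bar>gap_coeff l q i j * u\<bar>"
        proof cases
          case 1
          then have f: "\<delta> \<le> l i - l j" using far ij by blast
          have "d - gap_coeff l q i j * h = - (gap_coeff l q i j * u)"
            using eq 1 f gap(1) by (simp add: gap_coeff_def p_def field_simps)
          then show ?thesis using f gap(1) 1 by (auto simp: gap_coeff_def intro!: divide_left_mono)
        next
          case 2
          then have f: "\<delta> \<le> l j - l i" using far ij by blast
          have "d - gap_coeff l q i j * h = gap_coeff l q i j * u"
            using eq 2 f gap(1) by (simp add: gap_coeff_def p_def field_simps)
          then show ?thesis using f gap(1) 2 by (auto simp: gap_coeff_def intro!: divide_left_mono)
        qed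
        then show "\<bar>gap_coeff l q i j\<bar> \<le> 1 / \<delta>" "\<bar>d - gap_coeff l q i j * h\<bar> = \<bar>gap_coeff l q i j * u\<bar>"
          by auto
      qed
      have "\<bar>gap_coeff l q i j * u\<bar> \<le> 1 / \<delta> * (2 * (norm H)\<^sup>2 / \<delta>)"
        unfolding abs_mult using gam(1) u gap(1) by (intro mult_mono) auto
      then show ?thesis unfolding goal gam(2) by (simp add: power2_eq_square)
    qed
  qed
  \<comment> \<open>There are \<open>CARD('n)\<close> times \<open>CARD('n)\<close> entries, whence
    the factor \<open>CARD('n)\<close> after taking the root.\<close>
  have "(norm (\<Delta> - dproj e l q H))\<^sup>2 \<le> (\<Sum>k<CARD('n). \<Sum>i<CARD('n). (2 / \<delta>\<^sup>2 * (norm H)\<^sup>2)\<^sup>2)"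
    unfolding symmat_norm_orthonormal[OF e(1), of "\<Delta> - dproj e l q H"]
  proof (intro sum_mono)
    fix k i assume "k \<in> {..<CARD('n)}" "i \<in> {..<CARD('n)}"
    then have "\<bar>e i \<bullet> (mat_of (\<Delta> - dproj e l q H) *v e k)\<bar> \<le> \<bar>2 / \<delta>\<^sup>2 * (norm H)\<^sup>2\<bar>"
      using entry[of i k] by simp
    then show "(e i \<bullet> (mat_of (\<Delta> - dproj e l q H) *v e k))\<^sup>2 \<le> (2 / \<delta>\<^sup>2 * (norm H)\<^sup>2)\<^sup>2"
      by (simp only: abs_le_square_iff)
  qed
  also have "\<dots> = (2 * CARD('n) / \<delta>\<^sup>2 * (norm H)\<^sup>2)\<^sup>2"
    by (simp add: power_mult_distrib power_divide power2_eq_square)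
  finally have "norm (\<Delta> - dproj e l q H) \<le> 2 * CARD('n) / \<delta>\<^sup>2 * (norm H)\<^sup>2"
    by (rule power2_le_imp_le) simp
  then show ?thesis by (simp add: \<Delta>_def H_def P_def P'_def)
qed

section \<open>Tilt stability\<close>

text \<open>One constant serves all base points, and this yields more than differentiability: for
  \<open>k\<close> of length \<open>d = norm (y - x)\<close>, the vector
  \<open>(f' y - f' x) k\<close> combines three remainders among \<open>x\<close>, \<open>y\<close>
  and \<open>y + k\<close>, hence is of order \<open>d^2\<close>. So \<open>f'\<close> is locally
  Lipschitz.\<close>

lemma C1_on_quadratic_remainder:
  fixes f :: "'a::real_normed_vector \<Rightarrow> 'b::real_normed_vector" and f' :: "'a \<Rightarrow> 'a \<Rightarrow>\<^sub>L 'b"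
  assumes U: "open U" and C: "0 \<le> C"
    and rem: "\<And>x y. x \<in> U \<Longrightarrow> y \<in> U \<Longrightarrow> norm (f y - f x - f' x (y - x)) \<le> C * (norm (y - x))\<^sup>2"
  shows "\<And>x. x \<in> U \<Longrightarrow> (f has_derivative f' x) (at x)" and "C1_on f U"
proof -
  show der: "(f has_derivative f' x) (at x)" if x: "x \<in> U" for x
  proof -
    obtain \<rho> where \<rho>: "\<rho> > 0" "ball x \<rho> \<subseteq> U" using U x open_contains_ball by blast
    show ?thesis
    proof (rule has_derivativeI_sandwich[OF \<rho>(1)])
      show "bounded_linear (blinfun_apply (f' x))" by (rule blinfun.bounded_linear_right)
      show "((\<lambda>y. C * norm (y - x)) \<longlongrightarrow> 0) (at x)"
        by (rule tendsto_eq_intros | simp)+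
      fix y assume y: "y \<noteq> x" "dist y x < \<rho>"
      then have "y \<in> U" using \<rho>(2) by (auto simp: dist_commute subset_iff)
      from rem[OF x this] show "norm (f y - f x - f' x (y - x)) / norm (y - x) \<le> C * norm (y - x)"
        using y(1) by (simp add: divide_le_eq power2_eq_square mult.assoc)
    qed
  qed
  have "continuous_on U f'"
    unfolding continuous_on_iff
  proof (intro ballI allI impI)
    fix x and \<epsilon> :: real assume x: "x \<in> U" and eps: "0 < \<epsilon>"
    obtain \<rho> where \<rho>: "\<rho> > 0" "ball x \<rho> \<subseteq> U" using U x open_contains_ball by blast
    \<comment> \<open>\<open>\<rho> / 2\<close> keeps \<open>y + k\<close> in the ball. The 6 is
      \<open>4 + 1 + 1\<close>, from remainders over distances up to \<open>2 * d\<close>,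
      \<open>d\<close> and \<open>d\<close>; the added 1 covers \<open>C = 0\<close>.\<close>
    define d0 where "d0 = min (\<rho> / 2) (\<epsilon> / (6 * C + 1))"
    have "d0 > 0" using \<rho> eps C by (simp add: d0_def)
    moreover have "dist (f' y) (f' x) < \<epsilon>" if y: "y \<in> U" "dist y x < d0" for y
    proof -
      define d where "d = norm (y - x)"
      have d: "d < \<rho> / 2" "d < \<epsilon> / (6 * C + 1)" using y by (auto simp: d0_def d_def dist_norm)
      have "norm ((f' y - f' x) h) \<le> 6 * C * d * norm h" for h
      proof (cases "h = 0 \<or> d = 0")
        case True
        then show ?thesis by (auto simp: d_def)
      next
        case False
        then have hd: "norm h > 0" "d > 0" by (auto simp: d_def)
        define k where "k = (d / norm h) *\<^sub>R h"
        have k: "norm k = d" using hd by (simp add: k_def)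
        have "norm (y + k - x) \<le> 2 * d"
          using norm_triangle_ineq[of "y - x" k] k by (simp add: d_def algebra_simps)
        then have "y + k \<in> U" using d(1) \<rho>(2) by (auto simp: dist_norm norm_minus_commute subset_iff)
        have "norm (f (y + k) - f y - f' y (y + k - y)) \<le> C * d\<^sup>2"
          using rem[OF y(1) \<open>y + k \<in> U\<close>] k by simp
        moreover have "norm (f (y + k) - f x - f' x (y + k - x)) \<le> C * (2 * d)\<^sup>2"
          using rem[OF x \<open>y + k \<in> U\<close>] mult_left_mono[OF power_mono[OF \<open>norm (y + k - x) \<le> 2 * d\<close>, of 2] C]
          by simp
        moreover have "norm (f y - f x - f' x (y - x)) \<le> C * d\<^sup>2"
          using rem[OF x y(1)] by (simp add: d_def)
        moreover have "(f' y - f' x) k = (f (y + k) - f x - f' x (y + k - x))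
            - (f (y + k) - f y - f' y (y + k - y)) - (f y - f x - f' x (y - x))"
          by (simp add: blinfun.bilinear_simps algebra_simps)
        ultimately have "norm ((f' y - f' x) k) \<le> C * (2 * d)\<^sup>2 + C * d\<^sup>2 + C * d\<^sup>2"
          by (smt (verit) norm_triangle_ineq4)
        also have "\<dots> = 6 * C * d\<^sup>2" by (simp add: power2_eq_square)
        finally have "(d / norm h) * norm ((f' y - f' x) h) \<le> 6 * C * d\<^sup>2"
          using hd by (simp add: k_def blinfun.scaleR_right)
        then show ?thesis using hd by (simp add: field_simps power2_eq_square)
      qed
      then have "norm (f' y - f' x) \<le> 6 * C * d"
        using C by (intro norm_blinfun_bound) (auto simp: d_def)
      also have "\<dots> \<le> (6 * C + 1) * d" by (simp add: d_def algebra_simps)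
      also have "\<dots> < \<epsilon>" using d(2) C by (simp add: field_simps)
      finally show ?thesis by (simp add: dist_norm)
    qed
    ultimately show "\<exists>d>0. \<forall>y\<in>U. dist y x < d \<longrightarrow> dist (f' y) (f' x) < \<epsilon>" by blast
  qed
  then show "C1_on f U" unfolding C1_on_def using der by blast
qed

lemma C1_on_subset: "C1_on f U \<Longrightarrow> V \<subseteq> U \<Longrightarrow> C1_on f V"
  unfolding C1_on_def by (meson continuous_on_subset subsetD)

text \<open>One \<open>\<sigma>\<close> serves every radius \<open>\<epsilon>\<close>; only the
  neighbourhood of tilts shrinks. Thus any other solution map, given with a radius of its own, can
  be identified with \<open>\<sigma>\<close> near 0.\<close>

lemma tilted_solution_map:
  fixes S :: "'n::finite symmat"
  assumes f: "\<forall>R\<in>Gr q. f R = - (S \<bullet> R)"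
    and el: "eigensystem (mat_of S) e l" and q: "1 \<le> q" "q < CARD('n)" and gap: "l q < l (q - 1)"
  obtains \<sigma> r where "r > 0" "\<sigma> 0 = proj e q" "C1_on \<sigma> (ball 0 r)"
    "(\<sigma> has_derivative dproj e l q) (at 0)"
    "\<And>\<epsilon>. \<epsilon> > 0 \<Longrightarrow> \<exists>\<rho>>0. \<forall>v\<in>ball 0 \<rho>. tilt_argmin (Gr q) f (proj e q) \<epsilon> v = {\<sigma> v}"
proof -
  \<comment> \<open>Half the gap at \<open>S\<close>: tilts of norm below
    \<open>\<delta> / 2\<close> reduce the gap \<open>2 * \<delta>\<close> by less than
    \<open>\<delta>\<close>, so \<open>\<delta>\<close> is a common lower bound and the constants
    below are uniform.\<close>
  define \<delta> where "\<delta> = (l (q - 1) - l q) / 2"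
  have \<delta>: "\<delta> > 0" using gap by (simp add: \<delta>_def)
  \<comment> \<open>Eigensystems are chosen pointwise but pinned to \<open>(e, l)\<close> at 0, so
    that the derivative there is the given \<open>dproj e l q\<close>.\<close>
  have "\<exists>el'. eigensystem (mat_of (S + v)) (fst el') (snd el') \<and> (v = 0 \<longrightarrow> el' = (e, l))" for v
  proof (cases "v = 0")
    case True
    then show ?thesis using el by auto
  next
    case False
    obtain e' l' where "eigensystem (mat_of (S + v)) e' l'"
      using eigensystem_exists[OF transpose_mat_of] by blast
    then show ?thesis using False by auto
  qed
  then obtain EL where EL: "\<And>v. eigensystem (mat_of (S + v)) (fst (EL v)) (snd (EL v))" "EL 0 = (e, l)"
    by metis
  define E where "E v = fst (EL v)" for v
  define L where "L v = snd (EL v)" for v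
  have sys: "eigensystem (mat_of (S + v)) (E v) (L v)" for v using EL(1) by (simp add: E_def L_def)
  have E0: "E 0 = e" "L 0 = l" using EL(2) by (simp_all add: E_def L_def)
  define \<sigma> where "\<sigma> v = proj (E v) q" for v
  have \<sigma>Gr: "\<sigma> v \<in> Gr q" for v
    unfolding \<sigma>_def using eigensystemD(1)[OF sys[of v]] q by (intro proj_in_Gr) (simp add: orthonormal_def)
  have gaps: "\<delta> \<le> L v (q - 1) - L v q" if "v \<in> ball 0 (\<delta> / 2)" for v
  proof -
    have "l (q - 1) - l q - 2 * norm (S + v - S) \<le> L v (q - 1) - L v q"
      by (rule eigenvalue_gap_perturbation[OF el sys q])
    moreover have "2 * norm v < \<delta>" using that by simp
    moreover have "l (q - 1) - l q = 2 * \<delta>" by (simp add: \<delta>_def)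
    ultimately show ?thesis unfolding add_diff_cancel_left' by linarith
  qed
  have bl: "bounded_linear (dproj (E v) (L v) q)" for v
    using linear_dproj[OF eigensystemD(1)[OF sys[of v]]] linear_conv_bounded_linear by blast
  have rem: "norm (\<sigma> w - \<sigma> v - blinfun_apply (Blinfun (dproj (E v) (L v) q)) (w - v))
      \<le> 2 * CARD('n) / \<delta>\<^sup>2 * (norm (w - v))\<^sup>2"
    if "v \<in> ball 0 (\<delta> / 2)" "w \<in> ball 0 (\<delta> / 2)" for v w
    using spectral_projection_remainder[OF sys[of v] sys[of w] q \<delta> gaps[OF that(1)] gaps[OF that(2)]]
    by (simp add: \<sigma>_def bounded_linear_Blinfun_apply[OF bl])
  have r: "\<delta> / 2 > 0" using \<delta> by simp
  note C1' = C1_on_quadratic_remainder[of "ball 0 (\<delta> / 2)" "2 * CARD('n) / \<delta>\<^sup>2" \<sigma>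
      "\<lambda>v. Blinfun (dproj (E v) (L v) q)", OF open_ball _ rem]
  have C1: "C1_on \<sigma> (ball 0 (\<delta> / 2))" by (rule C1'(2)) simp_all
  have "(\<sigma> has_derivative blinfun_apply (Blinfun (dproj (E 0) (L 0) q))) (at 0)"
    by (rule C1'(1)) (use r in simp_all)
  then have der: "(\<sigma> has_derivative dproj e l q) (at 0)"
    using bounded_linear_Blinfun_apply[OF bl, of 0] by (simp add: E0)
  have \<sigma>0: "\<sigma> 0 = proj e q" by (simp add: \<sigma>_def E0)
  have am: "\<exists>\<rho>>0. \<forall>v\<in>ball 0 \<rho>. tilt_argmin (Gr q) f (proj e q) \<epsilon> v = {\<sigma> v}" if eps: "\<epsilon> > 0" for \<epsilon>
  proof (intro exI conjI ballI)
    \<comment> \<open>The Lipschitz constant \<open>1 / \<delta>\<close> keeps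
      \<open>\<sigma> v\<close> within \<open>\<epsilon>\<close> once
      \<open>norm v < \<epsilon> * \<delta>\<close>.\<close>
    show "min (\<delta> / 2) (\<epsilon> * \<delta>) > 0" using \<delta> eps by simp
    fix v :: "'n symmat" assume v: "v \<in> ball 0 (min (\<delta> / 2) (\<epsilon> * \<delta>))"
    then have v': "v \<in> ball 0 (\<delta> / 2)" by simp
    have "norm (\<sigma> v - proj e q) \<le> norm (S + v - S) / \<delta>"
      unfolding \<sigma>_def
      by (rule spectral_projection_lipschitz[OF el sys q \<delta> _ gaps[OF v']]) (use gap in \<open>simp add: \<delta>_def\<close>)
    also have "\<dots> \<le> \<epsilon>" using v \<delta> by (simp add: field_simps)
    finally have near: "\<sigma> v \<in> cball (proj e q) \<epsilon>" by (simp add: dist_norm norm_minus_commute)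
    have best: "\<delta> / 2 * (norm (\<sigma> v - R))\<^sup>2 \<le> (S + v) \<bullet> \<sigma> v - (S + v) \<bullet> R" if "R \<in> Gr q" for R
      using Gr_quadratic_growth[OF sys[of v] q that] gaps[OF v']
        mult_right_mono[of "\<delta> / 2" "(L v (q - 1) - L v q) / 2" "(norm (\<sigma> v - R))\<^sup>2"]
      by (simp add: \<sigma>_def)
    have opt: "(S + v) \<bullet> R \<le> (S + v) \<bullet> \<sigma> v" if "R \<in> Gr q" for R
    proof -
      have "0 \<le> \<delta> / 2 * (norm (\<sigma> v - R))\<^sup>2" using \<delta> by simp
      then show ?thesis using best[OF that] by linarith
    qed
    have uniq: "R = \<sigma> v" if "R \<in> Gr q" "(S + v) \<bullet> \<sigma> v \<le> (S + v) \<bullet> R" for R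
    proof -
      have "\<delta> / 2 * (norm (\<sigma> v - R))\<^sup>2 \<le> 0" using best[OF that(1)] that(2) by linarith
      then have "(norm (\<sigma> v - R))\<^sup>2 \<le> 0" using \<delta> by (simp add: mult_le_0_iff)
      then show ?thesis by simp
    qed
    show "tilt_argmin (Gr q) f (proj e q) \<epsilon> v = {\<sigma> v}"
      unfolding tilt_argmin_linear[OF f] using near opt uniq \<sigma>Gr[of v] by blast
  qed
  show ?thesis by (rule that[OF r \<sigma>0 C1 der am])
qed

lemma gap_tilt_stable:
  fixes S :: "'n::finite symmat"
  assumes f: "\<forall>R\<in>Gr q. f R = - (S \<bullet> R)"
    and el: "eigensystem (mat_of S) e l" and q: "1 \<le> q" "q < CARD('n)" and gap: "l q < l (q - 1)"
  shows "tilt_stable (Gr q) f (proj e q)"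
    and "reg_modulus (Gr q) f (proj e q) = ereal (1 / (l (q - 1) - l q))"
proof -
  obtain \<sigma> r where r: "r > 0" and \<sigma>0: "\<sigma> 0 = proj e q" and C1: "C1_on \<sigma> (ball 0 r)"
    and der: "(\<sigma> has_derivative dproj e l q) (at 0)"
    and am: "\<And>\<epsilon>. \<epsilon> > 0 \<Longrightarrow> \<exists>\<rho>>0. \<forall>v\<in>ball 0 \<rho>. tilt_argmin (Gr q) f (proj e q) \<epsilon> v = {\<sigma> v}"
    by (rule tilted_solution_map[OF f el q gap]) blast
  obtain \<rho> where \<rho>: "\<rho> > 0" "\<forall>v\<in>ball 0 \<rho>. tilt_argmin (Gr q) f (proj e q) 1 v = {\<sigma> v}"
    using am[of 1] by auto
  have tm: "tilt_map (Gr q) f (proj e q) \<sigma>"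
    unfolding tilt_map_def
  proof (intro exI[of _ 1] exI[of _ "ball 0 (min r \<rho>)"] conjI ballI)
    show "C1_on \<sigma> (ball 0 (min r \<rho>))"
      by (rule C1_on_subset[OF C1]) auto
  qed (use r \<rho> \<sigma>0 in auto)
  show stable: "tilt_stable (Gr q) f (proj e q)"
    unfolding tilt_stable_def using tm proj_is_arg_min[OF f el q] by blast
  \<comment> \<open>The modulus is defined through an arbitrary choice with an unknown radius;
    comparing the singletons at that radius gives \<open>\<tau> = \<sigma>\<close> near 0.\<close>
  define \<tau> where "\<tau> = (SOME \<sigma>. tilt_map (Gr q) f (proj e q) \<sigma>)"
  have "tilt_map (Gr q) f (proj e q) \<tau>" unfolding \<tau>_def using someI[of "tilt_map (Gr q) f (proj e q)" \<sigma>] tm by simp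
  then obtain \<epsilon> U where U: "\<epsilon> > 0" "open U" "0 \<in> U"
    "\<forall>v\<in>U. tilt_argmin (Gr q) f (proj e q) \<epsilon> v = {\<tau> v}"
    unfolding tilt_map_def by blast
  obtain \<rho>' where \<rho>': "\<rho>' > 0" "\<forall>v\<in>ball 0 \<rho>'. tilt_argmin (Gr q) f (proj e q) \<epsilon> v = {\<sigma> v}"
    using am[OF U(1)] by blast
  have "(\<tau> has_derivative dproj e l q) (at 0)"
  proof (rule has_derivative_transform_within_open[OF der, of "U \<inter> ball 0 \<rho>'"])
    show "\<sigma> v = \<tau> v" if "v \<in> U \<inter> ball 0 \<rho>'" for v using that U(4) \<rho>'(2) by auto
  qed (use U \<rho>' in auto)
  then have "frechet_derivative \<tau> (at 0) = dproj e l q" by (metis frechet_derivative_at)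
  then show "reg_modulus (Gr q) f (proj e q) = ereal (1 / (l (q - 1) - l q))"
    unfolding reg_modulus_def \<tau>_def[symmetric] using stable onorm_dproj[OF el q gap] by simp
qed

lemma gap_unique_arg_min:
  fixes S :: "'n::finite symmat"
  assumes f: "\<forall>R\<in>Gr q. f R = - (S \<bullet> R)"
    and el: "eigensystem (mat_of S) e l" and q: "1 \<le> q" "q < CARD('n)" and gap: "l q < l (q - 1)"
    and R: "is_arg_min f (\<lambda>R. R \<in> Gr q) R"
  shows "R = proj e q"
proof -
  have RG: "R \<in> Gr q" and "\<not> f (proj e q) < f R"
    using R proj_is_arg_min[OF f el q] by (auto simp: is_arg_min_def)
  then have "S \<bullet> proj e q \<le> S \<bullet> R"
    using f proj_is_arg_min[OF f el q] by (auto simp: is_arg_min_def)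
  then have "(l (q - 1) - l q) / 2 * (norm (proj e q - R))\<^sup>2 \<le> 0"
    using Gr_quadratic_growth[OF el q RG] by linarith
  then have "(norm (proj e q - R))\<^sup>2 \<le> 0" using gap by (simp add: mult_le_0_iff)
  then show ?thesis by simp
qed

section \<open>Second moments and exceptional distributions\<close>

lemma centered_measuresD:
  assumes "\<mu> \<in> centered_measures"
  shows "prob_space \<mu>" "sets \<mu> = sets borel" "integrable \<mu> (\<lambda>x. (norm x)\<^sup>2)" "(LINT x|\<mu>. x) = 0"
  using assms by (auto simp: centered_measures_def)

lemma centered_measurable:
  assumes "\<mu> \<in> centered_measures" "f \<in> measurable borel N" shows "f \<in> measurable \<mu> N"
  using assms centered_measuresD(2)[OF assms(1)] measurable_cong_sets by blast

lemma centered_integrable_inner2: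
  assumes \<mu>: "\<mu> \<in> centered_measures"
  shows "integrable \<mu> (\<lambda>x. (a \<bullet> x) * (b \<bullet> x))"
proof (rule Bochner_Integration.integrable_bound)
  show "integrable \<mu> (\<lambda>x. norm a * norm b * (norm x)\<^sup>2)"
    using centered_measuresD(3)[OF \<mu>] by simp
  show "(\<lambda>x. (a \<bullet> x) * (b \<bullet> x)) \<in> borel_measurable \<mu>"
    by (rule centered_measurable[OF \<mu>]) measurable
  have "\<bar>a \<bullet> x\<bar> * \<bar>b \<bullet> x\<bar> \<le> (norm a * norm x) * (norm b * norm x)" for x
    by (intro mult_mono Cauchy_Schwarz_ineq2) auto
  then show "AE x in \<mu>. norm ((a \<bullet> x) * (b \<bullet> x)) \<le> norm (norm a * norm b * (norm x)\<^sup>2)"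
    by (intro AE_I2) (simp add: abs_mult power2_eq_square mult_ac)
qed

lemma centered_integrable:
  assumes \<mu>: "\<mu> \<in> centered_measures"
  shows "integrable \<mu> (\<lambda>x. x)"
proof (rule Bochner_Integration.integrable_bound)
  interpret prob_space \<mu> by (rule centered_measuresD(1)[OF \<mu>])
  show "integrable \<mu> (\<lambda>x. 1 + (norm x)\<^sup>2)"
    using centered_measuresD(3)[OF \<mu>] by simp
  show "(\<lambda>x. x) \<in> borel_measurable \<mu>"
    by (rule centered_measurable[OF \<mu>]) measurable
  have "t \<le> 1 + t\<^sup>2" for t :: real
    using zero_le_power2[of "t - 1 / 2"] by (simp add: power2_eq_square algebra_simps)
  then show "AE x in \<mu>. norm x \<le> norm (1 + (norm x)\<^sup>2)"
    by (intro AE_I2) simp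
qed

lemma centered_inner_mean:
  assumes \<mu>: "\<mu> \<in> centered_measures"
  shows "(LINT x|\<mu>. a \<bullet> x) = 0"
  using centered_measuresD(4)[OF \<mu>] centered_integrable[OF \<mu>] by simp

lemma second_moment_form:
  fixes \<mu> :: "(real ^ 'n::finite) measure"
  assumes \<mu>: "\<mu> \<in> centered_measures"
  shows "a \<bullet> (second_moment_matrix \<mu> *v b) = (LINT x|\<mu>. (a \<bullet> x) * (b \<bullet> x))"
proof -
  have int: "integrable \<mu> (\<lambda>x. x $ i * x $ j)" for i j
    using centered_integrable_inner2[OF \<mu>, of "axis i 1" "axis j 1"] by (simp add: inner_axis')
  have "(LINT x|\<mu>. (a \<bullet> x) * (b \<bullet> x)) = (LINT x|\<mu>. (\<Sum>i\<in>UNIV. \<Sum>j\<in>UNIV. a $ i * b $ j * (x $ i * x $ j)))"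
    by (simp add: inner_vec_def sum_product mult_ac)
  also have "\<dots> = (\<Sum>i\<in>UNIV. \<Sum>j\<in>UNIV. a $ i * b $ j * (LINT x|\<mu>. x $ i * x $ j))"
    using int by simp
  also have "\<dots> = a \<bullet> (second_moment_matrix \<mu> *v b)"
    by (simp add: inner_vec_def matrix_vector_mult_def second_moment_matrix_def sum_distrib_left mult_ac)
  finally show ?thesis ..
qed

lemma transpose_second_moment [simp]: "transpose (second_moment_matrix \<mu>) = second_moment_matrix \<mu>"
  by (simp add: transpose_def second_moment_matrix_def vec_eq_iff mult.commute)

lemma mat_of_second_moment [simp]:
  "mat_of (symm (second_moment_matrix \<mu>)) = second_moment_matrix \<mu>"
  by (rule symm_inverse) simp

text \<open>Idempotence turns the squared norm of \<open>R x\<close> into the inner product of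
  \<open>x\<close> and \<open>R x\<close>, which is linear in \<open>R\<close>.\<close>

lemma pca_objective_Gr:
  assumes \<mu>: "\<mu> \<in> centered_measures" and R: "R \<in> Gr q"
  shows "pca_objective \<mu> R = symm (second_moment_matrix \<mu>) \<bullet> R"
proof -
  obtain b where b: "orthonormal b q" and Rb: "R = proj b q" using R Gr_iff_proj by blast
  have "(norm (mat_of R *v x))\<^sup>2 = (\<Sum>j<q. (b j \<bullet> x) * (b j \<bullet> x))" for x
    unfolding Gr_norm_mult[OF R] by (simp add: Rb proj_mult inner_sum_right inner_commute)
  then have "pca_objective \<mu> R = (\<Sum>j<q. LINT x|\<mu>. (b j \<bullet> x) * (b j \<bullet> x))"
    unfolding pca_objective_def using centered_integrable_inner2[OF \<mu>] by simp
  then show ?thesis by (simp add: Rb inner_proj second_moment_form[OF \<mu>])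
qed

lemma pca_maximizer_iff:
  "pca_maximizer q \<mu> R \<longleftrightarrow> is_arg_min (\<lambda>R. - pca_objective \<mu> R) (\<lambda>R. R \<in> Gr q) R"
  by (simp add: pca_maximizer_def is_arg_max_def is_arg_min_def)

lemma second_moment_eigenvalue:
  fixes \<mu> :: "(real ^ 'n::finite) measure"
  assumes \<mu>: "\<mu> \<in> centered_measures" and el: "eigensystem (second_moment_matrix \<mu>) e l"
    and jk: "j < CARD('n)" "k < CARD('n)"
  shows "(LINT x|\<mu>. (e j \<bullet> x) * (e k \<bullet> x)) = (if j = k then l k else 0)"
  using second_moment_form[OF \<mu>, of "e j" "e k"] eigensystemD(2)[OF el jk(2)]
    orthonormalD[OF eigensystemD(1)[OF el] jk] by (auto split: if_splits)

lemma second_moment_eigenvalue_nonneg: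
  fixes \<mu> :: "(real ^ 'n::finite) measure"
  assumes \<mu>: "\<mu> \<in> centered_measures" and el: "eigensystem (second_moment_matrix \<mu>) e l"
    and k: "k < CARD('n)"
  shows "0 \<le> l k"
proof -
  have "0 \<le> (LINT x|\<mu>. (e k \<bullet> x) * (e k \<bullet> x))" by simp
  then show ?thesis unfolding second_moment_eigenvalue[OF \<mu> el k k] by simp
qed

text \<open>The definition asks for some unstable maximizer. Without a gap \<open>proj e q\<close>
  is one; with a gap it is the only maximizer, and stable.\<close>

lemma pca_exceptional_iff:
  fixes \<mu> :: "(real ^ 'n::finite) measure"
  assumes \<mu>: "\<mu> \<in> centered_measures" and el: "eigensystem (second_moment_matrix \<mu>) e l"
    and q: "1 \<le> q" "q < CARD('n)"
  shows "\<mu> \<in> pca_exceptional q \<longleftrightarrow> l (q - 1) = l q"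
proof -
  let ?S = "symm (second_moment_matrix \<mu>)"
  have f: "\<forall>R\<in>Gr q. - pca_objective \<mu> R = - (?S \<bullet> R)" using pca_objective_Gr[OF \<mu>] by simp
  have el': "eigensystem (mat_of ?S) e l" using el by simp
  show ?thesis
  proof (cases "l (q - 1) = l q")
    case True
    then show ?thesis
      using no_gap_not_tilt_stable[OF f el' q] proj_is_arg_min[OF f el' q] \<mu>
      by (auto simp: pca_exceptional_def unstable_def pca_maximizer_iff)
  next
    case False
    then have gap: "l q < l (q - 1)" using eigensystemD(3)[OF el, of "q - 1" q] q by simp
    show ?thesis
      using gap_tilt_stable(1)[OF f el' q gap] gap_unique_arg_min[OF f el' q gap] False
      by (auto simp: pca_exceptional_def unstable_def pca_maximizer_iff)
  qed
qed

lemma pca_REG_gap: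
  fixes \<mu> :: "(real ^ 'n::finite) measure"
  assumes \<mu>: "\<mu> \<in> centered_measures" and el: "eigensystem (second_moment_matrix \<mu>) e l"
    and q: "1 \<le> q" "q < CARD('n)" and gap: "l q < l (q - 1)"
  shows "pca_REG q \<mu> = ereal (1 / (l (q - 1) - l q))"
proof -
  let ?S = "symm (second_moment_matrix \<mu>)"
  have f: "\<forall>R\<in>Gr q. - pca_objective \<mu> R = - (?S \<bullet> R)" using pca_objective_Gr[OF \<mu>] by simp
  have el': "eigensystem (mat_of ?S) e l" using el by simp
  have "pca_maximizer q \<mu> (proj e q)" using proj_is_arg_min[OF f el' q] by (simp add: pca_maximizer_iff)
  then have "pca_maximizer q \<mu> (SOME R. pca_maximizer q \<mu> R)" by (rule someI)
  then have "(SOME R. pca_maximizer q \<mu> R) = proj e q"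
    using gap_unique_arg_min[OF f el' q gap] by (simp add: pca_maximizer_iff)
  then show ?thesis using gap_tilt_stable(2)[OF f el' q gap] by (simp add: pca_REG_def)
qed

section \<open>Couplings and the Wasserstein distance\<close>

lemma borel_measurable_fst_snd [measurable]:
  "fst \<in> measurable borel (borel :: 'a::euclidean_space measure)"
  "snd \<in> measurable borel (borel :: 'a::euclidean_space measure)"
  by (intro borel_measurable_continuous_onI continuous_intros)+

lemma borel_measurable_pair:
  fixes X Y :: "'b \<Rightarrow> 'a::euclidean_space"
  assumes [measurable]: "X \<in> borel_measurable M" "Y \<in> borel_measurable M"
  shows "(\<lambda>\<omega>. (X \<omega>, Y \<omega>)) \<in> borel_measurable M"
  by measurable

text \<open>Pairs of random vectors on one probability space supply all the couplings constructed
  below.\<close>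

lemma distr_pair_in_couplings:
  fixes X Y :: "'b \<Rightarrow> 'a::euclidean_space"
  assumes M: "prob_space M" and X: "X \<in> borel_measurable M" and Y: "Y \<in> borel_measurable M"
  shows "distr M borel (\<lambda>\<omega>. (X \<omega>, Y \<omega>)) \<in> couplings (distr M borel X) (distr M borel Y)"
proof -
  note XY = borel_measurable_pair[OF X Y]
  have "distr (distr M borel (\<lambda>\<omega>. (X \<omega>, Y \<omega>))) borel fst = distr M borel X"
    by (subst distr_distr[OF borel_measurable_fst_snd(1) XY]) (simp add: o_def)
  moreover have "distr (distr M borel (\<lambda>\<omega>. (X \<omega>, Y \<omega>))) borel snd = distr M borel Y"
    by (subst distr_distr[OF borel_measurable_fst_snd(2) XY]) (simp add: o_def)
  ultimately show ?thesis
    using prob_space.prob_space_distr[OF M XY] by (simp add: couplings_def)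
qed

lemma W2_distr_le:
  fixes X Y :: "'b \<Rightarrow> 'a::euclidean_space"
  assumes M: "prob_space M" and X: "X \<in> borel_measurable M" and Y: "Y \<in> borel_measurable M"
  shows "W2 (distr M borel X) (distr M borel Y) \<le> sqrt (LINT \<omega>|M. (norm (X \<omega> - Y \<omega>))\<^sup>2)"
proof -
  let ?\<pi> = "distr M borel (\<lambda>\<omega>. (X \<omega>, Y \<omega>))"
  have "bdd_below ((\<lambda>\<pi>. sqrt (LINT z|\<pi>. (norm (fst z - snd z))\<^sup>2)) ` couplings (distr M borel X) (distr M borel Y))"
    by (rule bdd_belowI[of _ 0]) auto
  then have "W2 (distr M borel X) (distr M borel Y) \<le> sqrt (LINT z|?\<pi>. (norm (fst z - snd z))\<^sup>2)"
    unfolding W2_def by (rule cINF_lower[OF _ distr_pair_in_couplings[OF assms]])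
  also have "(LINT z|?\<pi>. (norm (fst z - snd z))\<^sup>2) = (LINT \<omega>|M. (norm (X \<omega> - Y \<omega>))\<^sup>2)"
    by (subst integral_distr[OF borel_measurable_pair[OF X Y]]) simp_all
  finally show ?thesis .
qed

text \<open>The product measure is a coupling. Lower bounds on \<open>W2\<close> rest on this,
  because a real \<open>INF\<close> over the empty set carries no information.\<close>

lemma couplings_nonempty:
  assumes \<mu>: "\<mu> \<in> centered_measures" and \<nu>: "\<nu> \<in> centered_measures"
  shows "couplings \<mu> \<nu> \<noteq> {}"
proof -
  interpret \<mu>: prob_space \<mu> by (rule centered_measuresD(1)[OF \<mu>])
  interpret \<nu>: prob_space \<nu> by (rule centered_measuresD(1)[OF \<nu>])
  interpret pair_prob_space \<mu> \<nu> ..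
  have s: "sets borel = sets \<mu>" "sets borel = sets \<nu>" using centered_measuresD(2) \<mu> \<nu> by auto
  have 1: "distr (\<mu> \<Otimes>\<^sub>M \<nu>) borel fst = \<mu>"
    by (rule trans[OF distr_cong[OF refl s(1) refl] \<nu>.distr_pair_fst])
  \<comment> \<open>Exchanging the factors turns the second marginal into a first one.\<close>
  have "distr (\<mu> \<Otimes>\<^sub>M \<nu>) borel snd = distr (\<mu> \<Otimes>\<^sub>M \<nu>) \<nu> snd" by (rule distr_cong[OF refl s(2) refl])
  also have "\<dots> = distr (distr (\<nu> \<Otimes>\<^sub>M \<mu>) (\<mu> \<Otimes>\<^sub>M \<nu>) (\<lambda>(x, y). (y, x))) \<nu> snd"
    by (subst distr_pair_swap) simp
  also have "\<dots> = distr (\<nu> \<Otimes>\<^sub>M \<mu>) \<nu> fst"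
    by (subst distr_distr) (auto simp: o_def case_prod_beta)
  also have "\<dots> = \<nu>" by (rule \<mu>.distr_pair_fst)
  finally have 2: "distr (\<mu> \<Otimes>\<^sub>M \<nu>) borel snd = \<nu>" .
  have "fst \<in> borel_measurable (\<mu> \<Otimes>\<^sub>M \<nu>)"
    unfolding measurable_cong_sets[OF refl s(1)] by (rule measurable_fst)
  moreover have "snd \<in> borel_measurable (\<mu> \<Otimes>\<^sub>M \<nu>)"
    unfolding measurable_cong_sets[OF refl s(2)] by (rule measurable_snd)
  ultimately show ?thesis
    using distr_pair_in_couplings[OF P.prob_space_axioms, of fst snd] unfolding 1 2 by blast
qed

section \<open>Lower bound on the distance to the exceptional set\<close>

text \<open>The integral of \<open>(s * X \<omega> + t * Y \<omega>)\<^sup>2\<close> is a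
  nonnegative quadratic form in \<open>s\<close> and \<open>t\<close>; suitable values bound
  \<open>c\<^sup>2\<close>.\<close>

lemma integral_Cauchy_Schwarz:
  fixes X Y :: "'b \<Rightarrow> real"
  assumes [simp]: "integrable M (\<lambda>\<omega>. (X \<omega>)\<^sup>2)" "integrable M (\<lambda>\<omega>. (Y \<omega>)\<^sup>2)" "integrable M (\<lambda>\<omega>. X \<omega> * Y \<omega>)"
  shows "(LINT \<omega>|M. X \<omega> * Y \<omega>) \<le> sqrt (LINT \<omega>|M. (X \<omega>)\<^sup>2) * sqrt (LINT \<omega>|M. (Y \<omega>)\<^sup>2)"
proof -
  define A B c where "A = (LINT \<omega>|M. (X \<omega>)\<^sup>2)" and "B = (LINT \<omega>|M. (Y \<omega>)\<^sup>2)"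
    and "c = (LINT \<omega>|M. X \<omega> * Y \<omega>)"
  have quad: "0 \<le> s\<^sup>2 * A + 2 * s * t * c + t\<^sup>2 * B" for s t
  proof -
    have "0 \<le> (LINT \<omega>|M. (s * X \<omega> + t * Y \<omega>)\<^sup>2)" by simp
    also have "(\<lambda>\<omega>. (s * X \<omega> + t * Y \<omega>)\<^sup>2)
        = (\<lambda>\<omega>. s\<^sup>2 * (X \<omega>)\<^sup>2 + 2 * s * t * (X \<omega> * Y \<omega>) + t\<^sup>2 * (Y \<omega>)\<^sup>2)"
      by (simp add: power2_eq_square algebra_simps)
    finally show ?thesis by (simp add: A_def B_def c_def)
  qed
  have nn: "0 \<le> A" "0 \<le> B" using quad[of 1 0] quad[of 0 1] by auto
  have "c\<^sup>2 \<le> A * B"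
  proof (cases "B = 0")
    case True
    \<comment> \<open>With \<open>s = c\<close> and \<open>t = - (A + 1) / 2\<close> the form
      collapses to \<open>- c\<^sup>2\<close>, forcing \<open>c = 0\<close>.\<close>
    have "0 \<le> c\<^sup>2 * A + 2 * c * (- (A + 1) / 2) * c + (- (A + 1) / 2)\<^sup>2 * B" by (rule quad)
    also have "\<dots> = - c\<^sup>2" using True by (simp add: power2_eq_square field_simps)
    finally show ?thesis using True by simp
  next
    case False
    \<comment> \<open>The minimizing ratio \<open>t / s = - c / B\<close>, scaled to
      \<open>s = B\<close> to avoid a division.\<close>
    have "0 \<le> B\<^sup>2 * A + 2 * B * (- c) * c + (- c)\<^sup>2 * B" by (rule quad)
    also have "\<dots> = B * (A * B - c\<^sup>2)" by (simp add: power2_eq_square algebra_simps)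
    finally show ?thesis using False nn by (simp add: zero_le_mult_iff)
  qed
  then have "c \<le> sqrt (A * B)" by (rule real_le_rsqrt)
  then show ?thesis by (simp add: A_def B_def c_def real_sqrt_mult)
qed

text \<open>The reverse triangle inequality of the \<open>L^2\<close> norm, squared.\<close>

lemma integral_diff_square_ge:
  fixes X Y :: "'b \<Rightarrow> real"
  assumes [simp]: "integrable M (\<lambda>\<omega>. (X \<omega>)\<^sup>2)" "integrable M (\<lambda>\<omega>. (Y \<omega>)\<^sup>2)" "integrable M (\<lambda>\<omega>. X \<omega> * Y \<omega>)"
  shows "integrable M (\<lambda>\<omega>. (X \<omega> - Y \<omega>)\<^sup>2)"
    and "(sqrt (LINT \<omega>|M. (X \<omega>)\<^sup>2) - sqrt (LINT \<omega>|M. (Y \<omega>)\<^sup>2))\<^sup>2 \<le> (LINT \<omega>|M. (X \<omega> - Y \<omega>)\<^sup>2)"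
proof -
  have eq: "(\<lambda>\<omega>. (X \<omega> - Y \<omega>)\<^sup>2) = (\<lambda>\<omega>. (X \<omega>)\<^sup>2 + (Y \<omega>)\<^sup>2 - 2 * (X \<omega> * Y \<omega>))"
    by (simp add: power2_eq_square algebra_simps)
  show "integrable M (\<lambda>\<omega>. (X \<omega> - Y \<omega>)\<^sup>2)" unfolding eq by simp
  show "(sqrt (LINT \<omega>|M. (X \<omega>)\<^sup>2) - sqrt (LINT \<omega>|M. (Y \<omega>)\<^sup>2))\<^sup>2 \<le> (LINT \<omega>|M. (X \<omega> - Y \<omega>)\<^sup>2)"
    unfolding eq using integral_Cauchy_Schwarz[OF assms] by (simp add: power2_diff)
qed

lemma couplingsD:
  fixes \<pi> :: "('a::euclidean_space \<times> 'a) measure"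
  assumes \<pi>: "\<pi> \<in> couplings \<mu> \<nu>" and g: "g \<in> borel_measurable borel"
  shows "integrable \<mu> g \<longleftrightarrow> integrable \<pi> (\<lambda>z. g (fst z) :: real)"
    and "integral\<^sup>L \<mu> g = (LINT z|\<pi>. g (fst z))"
    and "integrable \<nu> g \<longleftrightarrow> integrable \<pi> (\<lambda>z. g (snd z))"
    and "integral\<^sup>L \<nu> g = (LINT z|\<pi>. g (snd z))"
proof -
  have s: "sets \<pi> = sets borel" and d: "distr \<pi> borel fst = \<mu>" "distr \<pi> borel snd = \<nu>"
    using \<pi> by (auto simp: couplings_def)
  have m: "fst \<in> borel_measurable \<pi>" "snd \<in> borel_measurable \<pi>"
    using borel_measurable_fst_snd by (auto simp: measurable_cong_sets[OF s refl])
  show "integrable \<mu> g \<longleftrightarrow> integrable \<pi> (\<lambda>z. g (fst z))" "integrable \<nu> g \<longleftrightarrow> integrable \<pi> (\<lambda>z. g (snd z))"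
    unfolding d[symmetric] by (rule integrable_distr_eq[OF _ g]; rule m)+
  show "integral\<^sup>L \<mu> g = (LINT z|\<pi>. g (fst z))" "integral\<^sup>L \<nu> g = (LINT z|\<pi>. g (snd z))"
    unfolding d[symmetric] by (rule integral_distr[OF _ g]; rule m)+
qed

text \<open>Bessel's inequality splits off two orthonormal directions pointwise, and the reverse
  triangle inequality applies in each. The bound involves only the marginals, hence is the same for
  all couplings.\<close>

lemma coupling_cost_ge:
  fixes D \<nu> :: "(real ^ 'n::finite) measure"
  assumes D: "D \<in> centered_measures" and \<nu>: "\<nu> \<in> centered_measures" and \<pi>: "\<pi> \<in> couplings D \<nu>"
    and z: "norm z = 1" "norm z' = 1" "z \<bullet> z' = 0"
  shows "(sqrt (z \<bullet> (second_moment_matrix D *v z)) - sqrt (z \<bullet> (second_moment_matrix \<nu> *v z)))\<^sup>2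
    + (sqrt (z' \<bullet> (second_moment_matrix D *v z')) - sqrt (z' \<bullet> (second_moment_matrix \<nu> *v z')))\<^sup>2
    \<le> (LINT w|\<pi>. (norm (fst w - snd w))\<^sup>2)"
proof -
  have s: "sets \<pi> = sets borel" using \<pi> by (simp add: couplings_def)
  have meas: "f \<in> borel_measurable \<pi>" if "f \<in> borel_measurable borel" for f :: "(real ^ 'n) \<times> (real ^ 'n) \<Rightarrow> real"
    using that measurable_cong_sets[OF s refl] by blast
  have "integrable \<pi> (\<lambda>w. (norm (fst w))\<^sup>2)" "integrable \<pi> (\<lambda>w. (norm (snd w))\<^sup>2)"
    using couplingsD(1,3)[OF \<pi>, of "\<lambda>x. (norm x)\<^sup>2"] centered_measuresD(3) D \<nu> by auto
  then have sum: "integrable \<pi> (\<lambda>w. 2 * ((norm (fst w))\<^sup>2 + (norm (snd w))\<^sup>2))" by simp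
  have par: "(norm (x - y))\<^sup>2 \<le> 2 * ((norm x)\<^sup>2 + (norm y)\<^sup>2)" for x y :: "real ^ 'n"
    using zero_le_power2[of "norm (x + y)"] unfolding power2_norm_eq_inner
    by (simp add: inner_add_left inner_add_right inner_diff_left inner_diff_right inner_commute)
  have cost: "integrable \<pi> (\<lambda>w. (norm (fst w - snd w))\<^sup>2)"
  proof (rule Bochner_Integration.integrable_bound[OF sum])
    show "(\<lambda>w. (norm (fst w - snd w))\<^sup>2) \<in> borel_measurable \<pi>"
      by (rule meas) (intro borel_measurable_continuous_onI continuous_intros)
    show "AE w in \<pi>. norm ((norm (fst w - snd w))\<^sup>2) \<le> norm (2 * ((norm (fst w))\<^sup>2 + (norm (snd w))\<^sup>2))"
      using par by (intro AE_I2) simp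
  qed
  have dir: "integrable \<pi> (\<lambda>w. (u \<bullet> fst w - u \<bullet> snd w)\<^sup>2)"
    "(sqrt (u \<bullet> (second_moment_matrix D *v u)) - sqrt (u \<bullet> (second_moment_matrix \<nu> *v u)))\<^sup>2
      \<le> (LINT w|\<pi>. (u \<bullet> fst w - u \<bullet> snd w)\<^sup>2)" for u
  proof -
    have g: "(\<lambda>x. (u \<bullet> x)\<^sup>2) \<in> borel_measurable borel" by measurable
    have iD: "integrable \<pi> (\<lambda>w. (u \<bullet> fst w)\<^sup>2)" and i\<nu>: "integrable \<pi> (\<lambda>w. (u \<bullet> snd w)\<^sup>2)"
      using couplingsD(1,3)[OF \<pi> g] centered_integrable_inner2[OF D, of u u]
        centered_integrable_inner2[OF \<nu>, of u u] by (simp_all add: power2_eq_square)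
    have iX: "integrable \<pi> (\<lambda>w. (u \<bullet> fst w) * (u \<bullet> snd w))"
    proof (rule Bochner_Integration.integrable_bound)
      show "integrable \<pi> (\<lambda>w. (u \<bullet> fst w)\<^sup>2 + (u \<bullet> snd w)\<^sup>2)" using iD i\<nu> by simp
      show "(\<lambda>w. (u \<bullet> fst w) * (u \<bullet> snd w)) \<in> borel_measurable \<pi>"
        by (rule meas) (intro borel_measurable_continuous_onI continuous_intros)
      have "\<bar>s * t\<bar> \<le> s\<^sup>2 + t\<^sup>2" for s t :: real
      proof -
        have "2 * (\<bar>s\<bar> * \<bar>t\<bar>) \<le> s\<^sup>2 + t\<^sup>2"
          using sum_squares_bound[of "\<bar>s\<bar>" "\<bar>t\<bar>"] by (simp add: mult.assoc)
        moreover have "0 \<le> \<bar>s\<bar> * \<bar>t\<bar>" by simp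
        ultimately show ?thesis unfolding abs_mult by linarith
      qed
      then show "AE w in \<pi>. norm ((u \<bullet> fst w) * (u \<bullet> snd w)) \<le> norm ((u \<bullet> fst w)\<^sup>2 + (u \<bullet> snd w)\<^sup>2)"
        by (intro AE_I2) simp
    qed
    have eqs: "u \<bullet> (second_moment_matrix D *v u) = (LINT w|\<pi>. (u \<bullet> fst w)\<^sup>2)"
      "u \<bullet> (second_moment_matrix \<nu> *v u) = (LINT w|\<pi>. (u \<bullet> snd w)\<^sup>2)"
      using couplingsD(2,4)[OF \<pi> g] second_moment_form[OF D, of u u] second_moment_form[OF \<nu>, of u u]
      by (simp_all add: power2_eq_square)
    show "integrable \<pi> (\<lambda>w. (u \<bullet> fst w - u \<bullet> snd w)\<^sup>2)"
      by (rule integral_diff_square_ge(1)[OF iD i\<nu> iX])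
    show "(sqrt (u \<bullet> (second_moment_matrix D *v u)) - sqrt (u \<bullet> (second_moment_matrix \<nu> *v u)))\<^sup>2
      \<le> (LINT w|\<pi>. (u \<bullet> fst w - u \<bullet> snd w)\<^sup>2)"
      unfolding eqs by (rule integral_diff_square_ge(2)[OF iD i\<nu> iX])
  qed
  have zz: "z \<bullet> z = 1" "z' \<bullet> z' = 1" using z by (simp_all add: norm_eq_1)
  have "orthonormal (case_nat z (\<lambda>_. z')) 2"
    using z(3) zz by (auto simp: orthonormal_def less_2_cases_iff inner_commute)
  from bessel[OF this] have bes: "(z \<bullet> x)\<^sup>2 + (z' \<bullet> x)\<^sup>2 \<le> (norm x)\<^sup>2" for x
    by (simp add: numeral_2_eq_2)
  have "(LINT w|\<pi>. (z \<bullet> fst w - z \<bullet> snd w)\<^sup>2) + (LINT w|\<pi>. (z' \<bullet> fst w - z' \<bullet> snd w)\<^sup>2)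
      = (LINT w|\<pi>. (z \<bullet> fst w - z \<bullet> snd w)\<^sup>2 + (z' \<bullet> fst w - z' \<bullet> snd w)\<^sup>2)"
    using dir(1) by simp
  also have "\<dots> \<le> (LINT w|\<pi>. (norm (fst w - snd w))\<^sup>2)"
    by (rule integral_mono[OF _ cost]) (use dir(1) bes in \<open>auto simp: inner_diff_right[symmetric]\<close>)
  finally show ?thesis using dir(2)[of z] dir(2)[of z'] by linarith
qed

text \<open>\<open>z\<close> sees at least the \<open>q\<close>-th eigenvalue of \<open>D\<close> and at most that of \<open>\<nu>\<close>; for \<open>z'\<close> and the
  \<open>(q + 1)\<close>-st eigenvalue it is the other way round. Lying in complementary spectral subspaces of
  \<open>D\<close>, the two directions are orthogonal, so both discrepancies count towards the cost.\<close>

lemma W2_exceptional_ge: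
  fixes D \<nu> :: "(real ^ 'n::finite) measure"
  assumes D: "D \<in> centered_measures" and \<nu>: "\<nu> \<in> centered_measures"
    and el: "eigensystem (second_moment_matrix D) e l"
    and el': "eigensystem (second_moment_matrix \<nu>) e' l'"
    and q: "1 \<le> q" "q < CARD('n)" and gap: "l' (q - 1) = l' q"
  shows "1 / sqrt 2 * (sqrt (l (q - 1)) - sqrt (l q)) \<le> W2 D \<nu>"
proof -
  note e = eigensystemD[OF el] and e' = eigensystemD[OF el']
  \<comment> \<open>The index ranges for \<open>\<nu>\<close> overlap in \<open>q - 1\<close> and
    \<open>q\<close>, where \<open>l'\<close> takes one common value. The overlap supplies the extra
    dimension in both counts: those for \<open>z\<close> and \<open>z'\<close> each add up to
    \<open>CARD('n) + 1\<close>.\<close>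
  obtain z where z: "norm z = 1" "z \<in> span (e ` {..<q})" "z \<in> span (e' ` {q-1..<CARD('n)})"
    by (rule orthonormal_spans_meet[OF e(1) e'(1), of "{..<q}" "{q-1..<CARD('n)}"]) (use q in auto)
  obtain z' where z': "norm z' = 1" "z' \<in> span (e ` {q..<CARD('n)})" "z' \<in> span (e' ` {..q})"
    by (rule orthonormal_spans_meet[OF e(1) e'(1), of "{q..<CARD('n)}" "{..q}"]) (use q in auto)
  have sub: "{..<q} \<subseteq> {..<CARD('n)}" "{q..<CARD('n)} \<subseteq> {..<CARD('n)}" using q by auto
  have "(e i \<bullet> z) * (e i \<bullet> z') = 0" if "i < CARD('n)" for i
  proof (cases "i < q")
    case True
    then show ?thesis using orthonormal_span_zero[OF e(1) sub(2) z'(2) that] by simp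
  next
    case False
    then show ?thesis using orthonormal_span_zero[OF e(1) sub(1) z(2) that] by simp
  qed
  then have orth: "z \<bullet> z' = 0"
    unfolding parseval[OF e(1), of z z'] by (intro sum.neutral) auto
  define a b s where "a = sqrt (l (q - 1))" and "b = sqrt (l q)" and "s = sqrt (l' q)"
  have ab: "b \<le> a" using e(3)[of "q - 1" q] q by (simp add: a_def b_def)
  have "l (q - 1) \<le> z \<bullet> (second_moment_matrix D *v z)"
    by (rule quadratic_form_ge[OF _ el _ z(2,1)]) (use q e(3) in \<open>auto simp: less_imp_diff_less\<close>)
  then have 1: "a \<le> sqrt (z \<bullet> (second_moment_matrix D *v z))" by (simp add: a_def)
  have "z \<bullet> (second_moment_matrix \<nu> *v z) \<le> l' q"
    unfolding gap[symmetric]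
    by (rule quadratic_form_le[OF _ el' _ z(3,1)]) (use q e'(3) in auto)
  then have 2: "sqrt (z \<bullet> (second_moment_matrix \<nu> *v z)) \<le> s" by (simp add: s_def)
  have "z' \<bullet> (second_moment_matrix D *v z') \<le> l q"
    by (rule quadratic_form_le[OF _ el _ z'(2,1)]) (use q e(3) in auto)
  then have 3: "sqrt (z' \<bullet> (second_moment_matrix D *v z')) \<le> b" by (simp add: b_def)
  have "l' q \<le> z' \<bullet> (second_moment_matrix \<nu> *v z')"
    by (rule quadratic_form_ge[OF _ el' _ z'(3,1)]) (use q e'(3) in auto)
  then have 4: "s \<le> sqrt (z' \<bullet> (second_moment_matrix \<nu> *v z'))" by (simp add: s_def)
  \<comment> \<open>The unknown common deviation \<open>s\<close> cancels in
    \<open>(p - r) + (r' - p')\<close>. The factor 1/2 comes from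
    \<open>(x + y)\<^sup>2 \<le> 2 * (x\<^sup>2 + y\<^sup>2)\<close>, an equality when both moves
    have the same length.\<close>
  have num: "(a - b)\<^sup>2 / 2 \<le> (p - r)\<^sup>2 + (p' - r')\<^sup>2" if "a \<le> p" "r \<le> s" "p' \<le> b" "s \<le> r'" for p r p' r'
  proof -
    have "a - b \<le> (p - r) + (r' - p')" using that by linarith
    then have "(a - b)\<^sup>2 \<le> ((p - r) + (r' - p'))\<^sup>2" using ab by (intro power_mono) auto
    also have "\<dots> \<le> 2 * ((p - r)\<^sup>2 + (p' - r')\<^sup>2)"
      using zero_le_power2[of "(p - r) - (r' - p')"] by (simp add: power2_eq_square algebra_simps)
    finally show ?thesis by simp
  qed
  have "1 / sqrt 2 * (a - b) \<le> sqrt (LINT w|\<pi>. (norm (fst w - snd w))\<^sup>2)" if \<pi>: "\<pi> \<in> couplings D \<nu>" for \<pi>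
  proof (rule real_le_rsqrt)
    have "(1 / sqrt 2 * (a - b))\<^sup>2 = (a - b)\<^sup>2 / 2" by (simp add: power_mult_distrib power_divide)
    then show "(1 / sqrt 2 * (a - b))\<^sup>2 \<le> (LINT w|\<pi>. (norm (fst w - snd w))\<^sup>2)"
      using num[OF 1 2 3 4] coupling_cost_ge[OF D \<nu> \<pi> z(1) z'(1) orth] by linarith
  qed
  then show ?thesis
    unfolding W2_def a_def b_def by (intro cINF_greatest[OF couplings_nonempty[OF D \<nu>]])
qed

section \<open>Upper bound on the distance to the exceptional set\<close>

context
  fixes D :: "(real ^ 'n::finite) measure"
  assumes D: "D \<in> centered_measures"
begin

abbreviation coin :: "bool measure" where "coin \<equiv> measure_pmf (bernoulli_pmf (1 / 2))"

definition sgn_coin :: "bool \<Rightarrow> real" where "sgn_coin t = (if t then 1 else - 1)"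

lemma sgn_coin_square: "sgn_coin t * sgn_coin t = 1"
  by (simp add: sgn_coin_def)

lemma prob_space_D_coin: "prob_space (D \<Otimes>\<^sub>M coin)"
proof -
  interpret prob_space D by (rule centered_measuresD(1)[OF D])
  interpret pair_prob_space D coin ..
  show ?thesis by (rule P.prob_space_axioms)
qed

lemma fst_D_coin: "fst \<in> borel_measurable (D \<Otimes>\<^sub>M coin)" "distr (D \<Otimes>\<^sub>M coin) borel fst = D"
proof -
  have s: "sets borel = sets D" using centered_measuresD(2)[OF D] by simp
  show "fst \<in> borel_measurable (D \<Otimes>\<^sub>M coin)"
    unfolding measurable_cong_sets[OF refl s] by (rule measurable_fst)
  show "distr (D \<Otimes>\<^sub>M coin) borel fst = D"
    by (rule trans[OF distr_cong[OF refl s refl] prob_space.distr_pair_fst]) (rule prob_space_measure_pmf)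
qed

lemma snd_D_coin: "(\<lambda>w. sgn_coin (snd w)) \<in> borel_measurable (D \<Otimes>\<^sub>M coin)"
  by (rule measurable_compose[OF measurable_snd]) simp

text \<open>By Fubini the inner integral over the coin vanishes in the mixed term, since the sign
  has mean 0.\<close>

lemma integral_D_coin:
  fixes f :: "real ^ 'n \<Rightarrow> real"
  assumes f: "f \<in> borel_measurable borel" "integrable D f"
  shows "integrable (D \<Otimes>\<^sub>M coin) (\<lambda>w. f (fst w))" "(LINT w|(D \<Otimes>\<^sub>M coin). f (fst w)) = integral\<^sup>L D f"
    "integrable (D \<Otimes>\<^sub>M coin) (\<lambda>w. f (fst w) * sgn_coin (snd w))"
    "(LINT w|(D \<Otimes>\<^sub>M coin). f (fst w) * sgn_coin (snd w)) = 0"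
proof -
  interpret prob_space D by (rule centered_measuresD(1)[OF D])
  interpret pair_prob_space D coin ..
  have "integrable (distr (D \<Otimes>\<^sub>M coin) borel fst) f" using f(2) by (simp add: fst_D_coin(2))
  then show int: "integrable (D \<Otimes>\<^sub>M coin) (\<lambda>w. f (fst w))"
    by (subst (asm) integrable_distr_eq[OF fst_D_coin(1) f(1)])
  have "integral\<^sup>L (distr (D \<Otimes>\<^sub>M coin) borel fst) f = (LINT w|(D \<Otimes>\<^sub>M coin). f (fst w))"
    by (rule integral_distr[OF fst_D_coin(1) f(1)])
  then show "(LINT w|(D \<Otimes>\<^sub>M coin). f (fst w)) = integral\<^sup>L D f" by (simp add: fst_D_coin(2))
  show int': "integrable (D \<Otimes>\<^sub>M coin) (\<lambda>w. f (fst w) * sgn_coin (snd w))"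
  proof (rule Bochner_Integration.integrable_bound[OF int])
    show "(\<lambda>w. f (fst w) * sgn_coin (snd w)) \<in> borel_measurable (D \<Otimes>\<^sub>M coin)"
      by (intro borel_measurable_times measurable_compose[OF fst_D_coin(1) f(1)] snd_D_coin)
    show "AE w in D \<Otimes>\<^sub>M coin. norm (f (fst w) * sgn_coin (snd w)) \<le> norm (f (fst w))"
      by (intro AE_I2) (simp add: sgn_coin_def)
  qed
  have "(LINT w|(D \<Otimes>\<^sub>M coin). f (fst w) * sgn_coin (snd w)) = (LINT x|D. (LINT t|coin. f x * sgn_coin t))"
    using integral_fst'[OF int'] by simp
  also have "\<dots> = 0" by (simp add: sgn_coin_def)
  finally show "(LINT w|(D \<Otimes>\<^sub>M coin). f (fst w) * sgn_coin (snd w)) = 0" .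
qed

lemma mean_D_coin:
  "integrable (D \<Otimes>\<^sub>M coin) (\<lambda>w. \<alpha> * (u \<bullet> fst w) + \<beta> * sgn_coin (snd w))"
  "(LINT w|(D \<Otimes>\<^sub>M coin). \<alpha> * (u \<bullet> fst w) + \<beta> * sgn_coin (snd w)) = 0"
proof -
  interpret prob_space D by (rule centered_measuresD(1)[OF D])
  have m: "(\<lambda>x. u \<bullet> x) \<in> borel_measurable borel" by measurable
  have i: "integrable D (\<lambda>x. u \<bullet> x)" by (rule integrable_inner_right) (rule centered_integrable[OF D])
  note 1 = integral_D_coin(1,2)[OF m i, unfolded centered_inner_mean[OF D]]
  have c: "(\<lambda>x. 1) \<in> borel_measurable borel" "integrable D (\<lambda>x. 1)" by simp_all
  note 2 = integral_D_coin(3,4)[OF c, unfolded mult_1]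
  show "integrable (D \<Otimes>\<^sub>M coin) (\<lambda>w. \<alpha> * (u \<bullet> fst w) + \<beta> * sgn_coin (snd w))"
    by (intro Bochner_Integration.integrable_add integrable_mult_right 1 2)
  show "(LINT w|(D \<Otimes>\<^sub>M coin). \<alpha> * (u \<bullet> fst w) + \<beta> * sgn_coin (snd w)) = 0"
    by (subst Bochner_Integration.integral_add; (intro integrable_mult_right 1 2)?) (simp add: 1(2) 2(2))
qed

text \<open>Mixed terms vanish by independence, and the squared sign is 1. One formula serves both
  the second moments of the new measure and the transport cost, whose integrands have the same
  shape.\<close>

lemma covariance_D_coin:
  fixes u v :: "real ^ 'n" and \<alpha> \<beta> \<gamma> \<delta> :: real
  defines "F \<equiv> \<lambda>w. (\<alpha> * (u \<bullet> fst w) + \<beta> * sgn_coin (snd w)) * (\<gamma> * (v \<bullet> fst w) + \<delta> * sgn_coin (snd w))"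
  shows "integrable (D \<Otimes>\<^sub>M coin) F"
    "integral\<^sup>L (D \<Otimes>\<^sub>M coin) F = \<alpha> * \<gamma> * (LINT x|D. (u \<bullet> x) * (v \<bullet> x)) + \<beta> * \<delta>"
proof -
  interpret prob_space "D \<Otimes>\<^sub>M coin" by (rule prob_space_D_coin)
  have F: "F = (\<lambda>w. \<alpha> * \<gamma> * ((u \<bullet> fst w) * (v \<bullet> fst w)) + \<alpha> * \<delta> * ((u \<bullet> fst w) * sgn_coin (snd w))
      + \<beta> * \<gamma> * ((v \<bullet> fst w) * sgn_coin (snd w)) + \<beta> * \<delta>)"
  proof (rule ext)
    fix w :: "(real ^ 'n) \<times> bool"
    have "F w = \<alpha> * \<gamma> * ((u \<bullet> fst w) * (v \<bullet> fst w)) + \<alpha> * \<delta> * ((u \<bullet> fst w) * sgn_coin (snd w))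
      + \<beta> * \<gamma> * ((v \<bullet> fst w) * sgn_coin (snd w)) + \<beta> * \<delta> * (sgn_coin (snd w) * sgn_coin (snd w))"
      unfolding F_def by (simp add: algebra_simps)
    then show "F w = \<alpha> * \<gamma> * ((u \<bullet> fst w) * (v \<bullet> fst w)) + \<alpha> * \<delta> * ((u \<bullet> fst w) * sgn_coin (snd w))
      + \<beta> * \<gamma> * ((v \<bullet> fst w) * sgn_coin (snd w)) + \<beta> * \<delta>"
      by (simp add: sgn_coin_square)
  qed
  have 1: "integrable (D \<Otimes>\<^sub>M coin) (\<lambda>w. (u \<bullet> fst w) * (v \<bullet> fst w))"
    "(LINT w|(D \<Otimes>\<^sub>M coin). (u \<bullet> fst w) * (v \<bullet> fst w)) = (LINT x|D. (u \<bullet> x) * (v \<bullet> x))"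
    by (rule integral_D_coin(1,2)[of "\<lambda>x. (u \<bullet> x) * (v \<bullet> x)", OF _ centered_integrable_inner2[OF D]],
        measurable)+
  have 2: "integrable (D \<Otimes>\<^sub>M coin) (\<lambda>w. (a \<bullet> fst w) * sgn_coin (snd w))"
    "(LINT w|(D \<Otimes>\<^sub>M coin). (a \<bullet> fst w) * sgn_coin (snd w)) = 0" for a
  proof -
    have m: "(\<lambda>x. a \<bullet> x) \<in> borel_measurable borel" by measurable
    have i: "integrable D (\<lambda>x. a \<bullet> x)" by (rule integrable_inner_right) (rule centered_integrable[OF D])
    show "integrable (D \<Otimes>\<^sub>M coin) (\<lambda>w. (a \<bullet> fst w) * sgn_coin (snd w))"
      "(LINT w|(D \<Otimes>\<^sub>M coin). (a \<bullet> fst w) * sgn_coin (snd w)) = 0"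
      by (rule integral_D_coin(3,4)[OF m i])+
  qed
  show "integrable (D \<Otimes>\<^sub>M coin) F" unfolding F using 1 2 by simp
  show "integral\<^sup>L (D \<Otimes>\<^sub>M coin) F = \<alpha> * \<gamma> * (LINT x|D. (u \<bullet> x) * (v \<bullet> x)) + \<beta> * \<delta>"
    unfolding F using 1 2 prob_space by simp
qed

end

text \<open>The coordinates \<open>q\<close> and \<open>q + 1\<close> in the eigenbasis are rescaled to the common standard
  deviation \<open>c\<close>. A coordinate that vanishes almost surely cannot be rescaled; it is replaced by an
  independent random sign times \<open>c\<close> (and \<open>c / b = 0\<close> when \<open>b = 0\<close>).\<close>

lemma W2_exceptional_le:
  fixes D :: "(real ^ 'n::finite) measure"
  assumes D: "D \<in> centered_measures" and el: "eigensystem (second_moment_matrix D) e l"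
    and q: "1 \<le> q" "q < CARD('n)"
  obtains \<nu> where "\<nu> \<in> pca_exceptional q" "W2 D \<nu> \<le> 1 / sqrt 2 * (sqrt (l (q - 1)) - sqrt (l q))"
proof -
  note e = eigensystemD[OF el]
  define a b c where "a = sqrt (l (q - 1))" and "b = sqrt (l q)" and "c = (a + b) / 2"
  have nn: "0 \<le> l k" if "k < CARD('n)" for k by (rule second_moment_eigenvalue_nonneg[OF D el that])
  have q1: "q - 1 < CARD('n)" "q - 1 \<noteq> q" using q by auto
  have sq: "a\<^sup>2 = l (q - 1)" "b\<^sup>2 = l q" using nn q q1 by (simp_all add: a_def b_def)
  have ab: "0 \<le> b" "b \<le> a" using e(3)[of "q - 1" q] nn q by (simp_all add: a_def b_def)
  have c: "b \<le> c" "c \<le> a" using ab by (simp_all add: c_def)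
  define A where "A k = (if k = q - 1 then c / a else if k = q then c / b else 1)" for k
  \<comment> \<open>The sign occurs only at index \<open>q\<close>: if \<open>a = 0\<close>, then
    \<open>b \<le> a\<close> forces \<open>c = 0\<close>, and index \<open>q - 1\<close> has nothing
    to spread.\<close>
  define B where "B k = (if k = q \<and> b = 0 then c else 0)" for k
  define l' where "l' k = (if k = q - 1 \<or> k = q then c\<^sup>2 else l k)" for k
  define M where "M = D \<Otimes>\<^sub>M measure_pmf (bernoulli_pmf (1 / 2))"
  define Z where "Z k w = A k * (e k \<bullet> fst w) + B k * sgn_coin (snd w)" for k and w :: "(real ^ 'n) \<times> bool"
  define Y where "Y w = (\<Sum>k<CARD('n). Z k w *\<^sub>R e k)" for w
  define \<nu> where "\<nu> = distr M borel Y"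
  have lD: "(LINT x|D. (e j \<bullet> x) * (e k \<bullet> x)) = (if j = k then l k else 0)"
    if "j < CARD('n)" "k < CARD('n)" for j k
    by (rule second_moment_eigenvalue[OF D el that])
  have AB: "A k * A k * l k + B k * B k = l' k" for k
  proof -
    have "c / a * (c / a) * l (q - 1) = c\<^sup>2"
      using ab c unfolding sq[symmetric] by (cases "a = 0") (auto simp: power2_eq_square)
    moreover have "c / b * (c / b) * l q = c\<^sup>2" if "b \<noteq> 0"
      using that unfolding sq[symmetric] by (simp add: power2_eq_square)
    ultimately show ?thesis
      using q1 by (auto simp: A_def B_def l'_def power2_eq_square[of c])
  qed
  have eY: "e j \<bullet> Y w = Z j w" if "j < CARD('n)" for j w
  proof -
    have "e j \<bullet> Y w = (\<Sum>k<CARD('n). if k = j then Z j w else 0)"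
      unfolding Y_def inner_sum_right by (rule sum.cong) (use orthonormalD[OF e(1) that] in auto)
    then show ?thesis using that by simp
  qed
  have Mp: "prob_space M" unfolding M_def by (rule prob_space_D_coin[OF D])
  have fstM: "fst \<in> borel_measurable M" "distr M borel fst = D"
    unfolding M_def by (rule fst_D_coin[OF D])+
  have sM: "(\<lambda>w. sgn_coin (snd w)) \<in> borel_measurable M" unfolding M_def by (rule snd_D_coin[OF D])
  have YM: "Y \<in> borel_measurable M"
    unfolding Y_def Z_def using fstM(1) sM by measurable
  \<comment> \<open>Distinct coordinates stay uncorrelated: \<open>B j * B k = 0\<close> for
    \<open>j \<noteq> k\<close>, since at most one \<open>B\<close> is nonzero.\<close>
  have ZZ: "integrable M (\<lambda>w. Z j w * Z k w)" "(LINT w|M. Z j w * Z k w) = (if j = k then l' k else 0)"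
    if jk: "j < CARD('n)" "k < CARD('n)" for j k
    using covariance_D_coin[OF D, of "A j" "e j" "B j" "A k" "e k" "B k"] lD[OF jk] AB[of k]
    by (auto simp: Z_def M_def B_def mult_ac split: if_splits)
  have Ysq: "(norm (Y w))\<^sup>2 = (\<Sum>k<CARD('n). Z k w * Z k w)" for w
    unfolding power2_norm_eq_inner parseval[OF e(1), of "Y w" "Y w"] by (simp add: eY)
  have \<nu>: "\<nu> \<in> centered_measures"
    unfolding centered_measures_def
  proof (intro CollectI conjI)
    show "prob_space \<nu>" unfolding \<nu>_def by (rule prob_space.prob_space_distr[OF Mp YM])
    show "sets \<nu> = sets borel" by (simp add: \<nu>_def)
    show "integrable \<nu> (\<lambda>x. (norm x)\<^sup>2)"
      unfolding \<nu>_def by (subst integrable_distr_eq[OF YM]) (auto simp: Ysq intro!: Bochner_Integration.integrable_sum ZZ(1))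
    have "(LINT x|\<nu>. x) = (LINT w|M. Y w)" unfolding \<nu>_def by (subst integral_distr[OF YM]) simp_all
    also have "\<dots> = 0"
      unfolding Y_def using mean_D_coin[OF D] by (simp add: Z_def M_def)
    finally show "(LINT x|\<nu>. x) = 0" .
  qed
  have form: "e j \<bullet> (second_moment_matrix \<nu> *v e k) = (if j = k then l' k else 0)"
    if jk: "j < CARD('n)" "k < CARD('n)" for j k
  proof -
    have "e j \<bullet> (second_moment_matrix \<nu> *v e k) = (LINT w|M. (e j \<bullet> Y w) * (e k \<bullet> Y w))"
      unfolding second_moment_form[OF \<nu>] unfolding \<nu>_def by (subst integral_distr[OF YM]) simp_all
    then show ?thesis using ZZ(2)[OF jk] by (simp add: eY jk)
  qed
  have el': "eigensystem (second_moment_matrix \<nu>) e l'"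
    unfolding eigensystem_def
  proof (intro conjI allI impI)
    show "orthonormal e CARD('n)" by (rule e(1))
    show "second_moment_matrix \<nu> *v e k = l' k *\<^sub>R e k" if k: "k < CARD('n)" for k
    proof -
      have "second_moment_matrix \<nu> *v e k = (\<Sum>j<CARD('n). (e j \<bullet> (second_moment_matrix \<nu> *v e k)) *\<^sub>R e j)"
        by (rule orthonormal_expand[OF e(1)])
      also have "\<dots> = (\<Sum>j<CARD('n). if j = k then l' k *\<^sub>R e k else 0)"
        by (rule sum.cong) (use form[OF _ k] in auto)
      finally show ?thesis using k by simp
    qed
    \<comment> \<open>As \<open>c\<close> lies between \<open>b\<close> and \<open>a\<close>,
      putting \<open>c\<^sup>2\<close> at both places keeps the eigenvalues decreasing, and
      \<open>e\<close> stays an ordered eigenbasis.\<close>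
    have cl: "c\<^sup>2 \<le> l (q - 1)" "l q \<le> c\<^sup>2"
      using c ab power_mono[of c a 2] power_mono[of b c 2] unfolding sq[symmetric] by auto
    show "l' j \<le> l' i" if ij: "i \<le> j" "j < CARD('n)" for i j
    proof -
      have "l j \<le> c\<^sup>2" if "q < j" using e(3)[of q j] ij cl(2) that by simp
      moreover have "c\<^sup>2 \<le> l i" if "i < q - 1" using e(3)[of i "q - 1"] q1 cl(1) that by simp
      moreover have "l j \<le> l i" by (rule e(3)[OF ij])
      ultimately show ?thesis using ij(1) unfolding l'_def by auto
    qed
  qed
  have exc: "\<nu> \<in> pca_exceptional q"
    using pca_exceptional_iff[OF \<nu> el' q] by (simp add: l'_def)
  \<comment> \<open>The displacement has coordinates of the same form as \<open>Z\<close>, with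
    coefficients \<open>1 - A k\<close> and \<open>- B k\<close>, so the covariance formula
    evaluates the cost.\<close>
  have diff: "(norm (fst w - Y w))\<^sup>2
      = (\<Sum>k<CARD('n). ((1 - A k) * (e k \<bullet> fst w) + (- B k) * sgn_coin (snd w))
          * ((1 - A k) * (e k \<bullet> fst w) + (- B k) * sgn_coin (snd w)))" for w
    unfolding power2_norm_eq_inner parseval[OF e(1), of "fst w - Y w" "fst w - Y w"]
    by (intro sum.cong refl) (simp add: inner_diff_right eY Z_def algebra_simps)
  have "(LINT w|M. (norm (fst w - Y w))\<^sup>2)
      = (\<Sum>k<CARD('n). (1 - A k) * (1 - A k) * l k + B k * B k)"
    unfolding diff M_def
    by (simp only: Bochner_Integration.integral_sum covariance_D_coin[OF D]) (simp add: lD)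
  also have "\<dots> = (\<Sum>k\<in>{q - 1, q}. (1 - A k) * (1 - A k) * l k + B k * B k)"
    by (rule sum.mono_neutral_right) (use q in \<open>auto simp: A_def B_def\<close>)
  also have "\<dots> = (a - c)\<^sup>2 + (b - c)\<^sup>2"
  proof -
    have "(1 - c / a) * (1 - c / a) * l (q - 1) = (a - c)\<^sup>2"
      unfolding sq[symmetric] using ab c by (cases "a = 0") (auto simp: power2_eq_square field_simps)
    moreover have "(1 - A q) * (1 - A q) * l q + B q * B q = (b - c)\<^sup>2"
      unfolding sq[symmetric] using q1
      by (cases "b = 0") (auto simp: A_def B_def power2_eq_square field_simps)
    ultimately show ?thesis using q1 by (simp add: A_def B_def)
  qed
  also have "\<dots> = (a - b)\<^sup>2 / 2" by (simp add: c_def power2_eq_square field_simps)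
  finally have cost: "(LINT w|M. (norm (fst w - Y w))\<^sup>2) = (a - b)\<^sup>2 / 2" .
  have "W2 D \<nu> \<le> sqrt (LINT w|M. (norm (fst w - Y w))\<^sup>2)"
    using W2_distr_le[OF Mp fstM(1) YM] by (simp add: fstM(2) \<nu>_def)
  also have "\<dots> = 1 / sqrt 2 * (a - b)" unfolding cost using ab by (simp add: real_sqrt_divide)
  finally show ?thesis using exc that by (simp add: a_def b_def)
qed

theorem theorem3p4:
  fixes D :: "(real ^ 'd::finite) measure" and q :: nat
  assumes "1 \<le> q" and "q \<le> CARD('d) - 1"
    and "D \<in> centered_measures"
  shows "pca_RSE q D =
           1 / sqrt 2 * (sqrt (eigval q (second_moment_matrix D))
                         - sqrt (eigval (q + 1) (second_moment_matrix D))) \<and>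
         (D \<notin> pca_exceptional q \<longrightarrow>
           ereal (pca_RSE q D) * pca_REG q D =
           ereal (1 / (sqrt 2 * (sqrt (eigval q (second_moment_matrix D))
                                 + sqrt (eigval (q + 1) (second_moment_matrix D))))))"
proof -
  note D = assms(3)
  have "0 < CARD('d)" by simp
  then have q: "1 \<le> q" "q < CARD('d)" using assms(1,2) by linarith+
  obtain e l where el: "eigensystem (second_moment_matrix D) e l"
    using eigensystem_exists[OF transpose_second_moment] by blast
  define a b where "a = sqrt (l (q - 1))" and "b = sqrt (l q)"
  have "eigval (Suc (q - 1)) (second_moment_matrix D) = l (q - 1)"
    using q by (intro eigval_eigensystem[OF transpose_second_moment el]) simp
  then have ev: "sqrt (eigval q (second_moment_matrix D)) = a"
    "sqrt (eigval (q + 1) (second_moment_matrix D)) = b"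
    using q eigval_eigensystem[OF transpose_second_moment el q(2)] by (simp_all add: a_def b_def)
  have lower: "1 / sqrt 2 * (a - b) \<le> W2 D \<nu>" if \<nu>: "\<nu> \<in> pca_exceptional q" for \<nu>
  proof -
    have \<nu>c: "\<nu> \<in> centered_measures" using \<nu> by (simp add: pca_exceptional_def)
    obtain e' l' where el': "eigensystem (second_moment_matrix \<nu>) e' l'"
      using eigensystem_exists[OF transpose_second_moment] by blast
    have "l' (q - 1) = l' q" using pca_exceptional_iff[OF \<nu>c el' q] \<nu> by simp
    from W2_exceptional_ge[OF D \<nu>c el el' q this] show ?thesis by (simp add: a_def b_def)
  qed
  \<comment> \<open>The witness also shows that the exceptional set is nonempty, so its real
    \<open>INF\<close> is meaningful.\<close>
  obtain \<nu>\<^sub>0 where \<nu>\<^sub>0: "\<nu>\<^sub>0 \<in> pca_exceptional q" "W2 D \<nu>\<^sub>0 \<le> 1 / sqrt 2 * (a - b)"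
    using W2_exceptional_le[OF D el q] unfolding a_def b_def by blast
  have RSE: "pca_RSE q D = 1 / sqrt 2 * (a - b)"
    unfolding pca_RSE_def W2_set_def
  proof (rule antisym)
    show "(INF \<nu>\<in>pca_exceptional q. W2 D \<nu>) \<le> 1 / sqrt 2 * (a - b)"
    proof (rule cINF_lower2[where x = \<nu>\<^sub>0])
      show "bdd_below (W2 D ` pca_exceptional q)"
        using lower by (auto intro!: bdd_belowI[of _ "1 / sqrt 2 * (a - b)"])
    qed (use \<nu>\<^sub>0 in auto)
    show "1 / sqrt 2 * (a - b) \<le> (INF \<nu>\<in>pca_exceptional q. W2 D \<nu>)"
      using \<nu>\<^sub>0(1) lower by (intro cINF_greatest) auto
  qed
  have "ereal (pca_RSE q D) * pca_REG q D = ereal (1 / (sqrt 2 * (a + b)))" if "D \<notin> pca_exceptional q"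
  proof -
    have gap: "l q < l (q - 1)"
      using that pca_exceptional_iff[OF D el q] eigensystemD(3)[OF el, of "q - 1" q] q by simp
    have nn: "0 \<le> l q" "0 \<le> l (q - 1)" using second_moment_eigenvalue_nonneg[OF D el] q by auto
    have ab: "0 \<le> b" "b < a" using gap nn by (simp_all add: a_def b_def)
    \<comment> \<open>The modulus is the reciprocal of this product: \<open>a - b\<close> cancels
      against the radius and \<open>a + b\<close> remains.\<close>
    have "l (q - 1) - l q = (a - b) * (a + b)"
      using nn by (simp add: a_def b_def algebra_simps)
    then have "1 / sqrt 2 * (a - b) * (1 / (l (q - 1) - l q)) = 1 / (sqrt 2 * (a + b))"
      using ab by simp
    then show ?thesis unfolding RSE pca_REG_gap[OF D el q gap] by simp
  qed
  then show ?thesis unfolding ev using RSE by blast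
qed

end
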